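(* Let $\ast$ be a continuous t-norm. The natural transformation $l:\Pi\to A^\ast$ with components $lX:\Pi X\to A^\ast X$, $lX(\nu)(\varphi)=\int_X^{\vee\ast}\varphi\,d\nu$ for $\nu\in\Pi X$ and $\varphi\in C(X,[0,1])$, is an isomorphism of the monads $\mathbb U_\ast=(\Pi,\eta,\mu_\ast)$ and $\mathbb A^\ast=(A^\ast,h,m)$ on the category of compact Hausdorff spaces and continuous maps.
   Context: Compactum means compact Hausdorff space; all maps between compacta are continuous. A t-norm is a binary operation $\ast$ on $[0,1]$ that is associative, commutative, monotone, and satisfies $s\ast 1=s$ for all $s$. $C(X,[0,1])$ is the set of continuous functions $X\to[0,1]$, $c_X$ is the constant function with value $c$; $\vee$ (maximum) and $\ast$ act pointwise on functions. Monads. A monad $\mathbb E=(E,\eta,\mu)$ on the category $\mathsf{Comp}$ of compacta and continuous maps is an endofunctor $E$ with natural transformations $\eta:\mathrm{Id}\to E$, $\mu:E^2\to E$ such that $\mu\circ E\eta=\mu\circ\eta E=1_E$ and $\mu\circ\mu E=\mu\circ E\mu$. A morphism from a monad $(E,\eta,\mu)$ to a monad $(E',\eta',\mu')$ is a natural transformation $\psi:E\to E'$ with $\psi\circ\eta=\eta'$ and $\psi\circ\mu=\mu'\circ\psi E'\circ E\psi$; it is an isomorphism if it has an inverse monad morphism. Capacities. A capacity on a compactum $X$ is a function $\nu$ from the closed subsets of $X$ to $[0,1]$ such that: (1) $\nu(X)=1$, $\nu(\emptyset)=0$; (2) $F\subset G$ implies $\nu(F)\le\nu(G)$; (3) if $\nu(F)<a$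 for $a\in[0,1]$, there is an open $O\supset F$ with $\nu(B)<a$ for each compact $B\subset O$. For open $U$ put $\nu(U)=\sup\{\nu(K)\mid K\subset U \text{ closed in } X\}$. The set $MX$ of all capacities carries the topology with subbase of all sets $\{c\in MX\mid c(F)<a\}$ ($F$ closed, $a\in[0,1]$) and $\{c\in MX\mid c(U)>a\}$ ($U$ open, $a\in[0,1]$); it is a compactum. $\Pi X\subset MX$ is the closed subspace of possibility capacities: those $\nu$ with $\nu(\bigcup_{t}A_t)=\sup_{t}\nu(A_t)$ for each family of closed sets $A_t$ with closed union (equivalently $\nu(A\cup B)=\max\{\nu(A),\nu(B)\}$ for closed $A,B$). The monad $\mathbb U_\ast=(\Pi,\eta,\mu_\ast)$. For $f:X\to Y$, $\Pi f(\nu)(A)=\nu(f^{-1}(A))$ for $\nu\in\Pi X$ and $A$ closed in $Y$. $\eta X(x)(F)=1$ if $x\in F$ and $0$ if $x\notin F$. For $F\subset X$ closed and $t\in[0,1]$ put $F_t=\{c\in\Pi X\mid c(F)\ge t\}$; then $\mu_\ast X:\Pi^2X\to\Pi X$ is given by $\mu_\ast X(\mathcal C)(F)=\max\{\mathcal C(F_t)\ast t\mid t\in(0,1]\}$. This is known to be a monad. The t-normed integral. For $f\in C(X,[0,1])$ put $f_t=f^{-1}([t,1])$ and $\int_X^{\vee\ast}f\,d\nu=\max\{\nu(f_t)\ast t\mid t\in[0,1]\}$. The monad $\mathbb A^\ast=(A^\ast,h,m)$. $A^\ast X$ is the set of $\ast$-measures, i.e. functionals $\mu:C(X,[0,1])\to[0,1]$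 with $\mu(1_X)=1$, $\mu(\psi\vee\varphi)=\mu(\psi)\vee\mu(\varphi)$ for all $\varphi,\psi$, and $\mu(c_X\ast\varphi)=c\ast\mu(\varphi)$ for all $c\in[0,1]$ and $\varphi$; it has the subspace topology from the product $[0,1]^{C(X,[0,1])}$ and is a compactum. For $\phi\in C(X,[0,1])$, $\pi_\phi=\pi(\phi):A^\ast X\to[0,1]$ is $\pi_\phi(\mu)=\mu(\phi)$. For $f:X\to Y$, $A^\ast f$ is given by $\pi_\phi\circ A^\ast f=\pi_{\phi\circ f}$ for $\phi\in C(Y,[0,1])$. The components $hX:X\to A^\ast X$ and $mX:A^\ast(A^\ast X)\to A^\ast X$ are given by $\pi_\phi\circ hX=\phi$ and $\pi_\phi\circ mX=\pi(\pi_\phi)$ for all $\phi\in C(X,[0,1])$. *)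

theory Defs
  imports "HOL-Analysis.Analysis"
begin

text \<open>
  Sets of functions are sets of extensional functions: a capacity on \<open>X\<close> is \<open>undefined\<close> outside the
  closed subsets of \<open>X\<close>, an element of \<open>C(X,[0,1])\<close> is \<open>undefined\<close> outside \<open>topspace X\<close>, and a
  functional is \<open>undefined\<close> outside \<open>C(X,[0,1])\<close>.  Hence equality of points of the spaces below is
  equality in HOL.
\<close>

definition compactum :: "'a topology \<Rightarrow> bool" where
  "compactum X \<longleftrightarrow> compact_space X \<and> Hausdorff_space X"

text \<open>\<^const>\<open>Max\<close> is meant for finite sets only.  If the greatest element does not exist, the value
  is unspecified.\<close>

definition maximum :: "real set \<Rightarrow> real" where
  "maximum S = (GREATEST x. x \<in> S)"


section \<open>Triangular norms\<close>

definition tnorm :: "(real \<Rightarrow> real \<Rightarrow> real) \<Rightarrow> bool" where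
  "tnorm T \<longleftrightarrow>
     (\<forall>x\<in>{0..1}. \<forall>y\<in>{0..1}. T x y \<in> {0..1}) \<and>
     (\<forall>x\<in>{0..1}. \<forall>y\<in>{0..1}. \<forall>z\<in>{0..1}. T (T x y) z = T x (T y z)) \<and>
     (\<forall>x\<in>{0..1}. \<forall>y\<in>{0..1}. T x y = T y x) \<and>
     (\<forall>x\<in>{0..1}. \<forall>x'\<in>{0..1}. \<forall>y\<in>{0..1}. \<forall>y'\<in>{0..1}.
        x \<le> x' \<longrightarrow> y \<le> y' \<longrightarrow> T x y \<le> T x' y') \<and>
     (\<forall>s\<in>{0..1}. T s 1 = s)"

definition continuous_tnorm :: "(real \<Rightarrow> real \<Rightarrow> real) \<Rightarrow> bool" where
  "continuous_tnorm T \<longleftrightarrow>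
     tnorm T \<and> continuous_on ({0..1} \<times> {0..1}) (\<lambda>(x, y). T x y)"


section \<open>Monad morphisms on the category of compacta\<close>

text \<open>
  An endofunctor of the category of compacta acts on types as well, and HOL cannot quantify over
  type constructors.  So the data of a monad \<open>(E,\<eta>,\<mu>)\<close> are recorded at an arbitrary pair of types
  \<open>'a\<close>, \<open>'b\<close>: \<open>fobj\<close> and \<open>fobj'\<close> are the action of \<open>E\<close> on spaces over \<open>'a\<close> and \<open>'b\<close>, \<open>fmap X Y f\<close> is
  \<open>E f\<close> for \<open>f : X \<rightarrow> Y\<close>, and \<open>fobj2\<close> is \<open>E\<^sup>2\<close>.  A concrete monad is a constant that is polymorphic in
  \<open>'a\<close> and \<open>'b\<close>; a statement about it with \<open>'a\<close> and \<open>'b\<close> free covers all compacta.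
  The monad laws are not part of these definitions: a morphism of monads is a natural
  transformation, between functors already known to be monads, that respects \<open>\<eta>\<close> and \<open>\<mu>\<close>.
\<close>

record ('a, 'b, 'ea, 'eb, 'eea) monad_data =
  fobj :: "'a topology \<Rightarrow> 'ea topology"
  fobj' :: "'b topology \<Rightarrow> 'eb topology"
  fobj2 :: "'a topology \<Rightarrow> 'eea topology"
  fmap :: "'a topology \<Rightarrow> 'b topology \<Rightarrow> ('a \<Rightarrow> 'b) \<Rightarrow> 'ea \<Rightarrow> 'eb"
  munit :: "'a topology \<Rightarrow> 'a \<Rightarrow> 'ea"
  mmult :: "'a topology \<Rightarrow> 'eea \<Rightarrow> 'ea"

text \<open>\<open>\<psi>\<close> and \<open>\<psi>'\<close> are the components of one transformation \<open>E \<rightarrow> E'\<close> at spaces over \<open>'a\<close> and \<open>'b\<close>.\<close>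

definition natural_transformation ::
  "('a, 'b, 'ea, 'eb, 'eea) monad_data \<Rightarrow> ('a, 'b, 'fa, 'fb, 'ffa) monad_data \<Rightarrow>
   ('a topology \<Rightarrow> 'ea \<Rightarrow> 'fa) \<Rightarrow> ('b topology \<Rightarrow> 'eb \<Rightarrow> 'fb) \<Rightarrow> bool" where
  "natural_transformation M N \<psi> \<psi>' \<longleftrightarrow>
     (\<forall>X. compactum X \<longrightarrow> continuous_map (fobj M X) (fobj N X) (\<psi> X)) \<and>
     (\<forall>Y. compactum Y \<longrightarrow> continuous_map (fobj' M Y) (fobj' N Y) (\<psi>' Y)) \<and>
     (\<forall>X Y f. compactum X \<and> compactum Y \<and> continuous_map X Y f \<longrightarrow>
        (\<forall>z\<in>topspace (fobj M X). fmap N X Y f (\<psi> X z) = \<psi>' Y (fmap M X Y f z)))"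

text \<open>\<open>\<psi>\<psi> X\<close> stands for the composite \<open>\<psi>(E'X) \<circ> E(\<psi>X) : E\<^sup>2X \<rightarrow> E'\<^sup>2X\<close>, which uses further type
  instances of \<open>\<psi>\<close> and \<open>E\<close>.\<close>

definition monad_morphism ::
  "('a, 'b, 'ea, 'eb, 'eea) monad_data \<Rightarrow> ('a, 'b, 'fa, 'fb, 'ffa) monad_data \<Rightarrow>
   ('a topology \<Rightarrow> 'ea \<Rightarrow> 'fa) \<Rightarrow> ('b topology \<Rightarrow> 'eb \<Rightarrow> 'fb) \<Rightarrow>
   ('a topology \<Rightarrow> 'eea \<Rightarrow> 'ffa) \<Rightarrow> bool" where
  "monad_morphism M N \<psi> \<psi>' \<psi>\<psi> \<longleftrightarrow>
     natural_transformation M N \<psi> \<psi>' \<and>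
     (\<forall>X. compactum X \<longrightarrow> (\<forall>x\<in>topspace X. \<psi> X (munit M X x) = munit N X x)) \<and>
     (\<forall>X. compactum X \<longrightarrow>
        (\<forall>w\<in>topspace (fobj2 M X). \<psi> X (mmult M X w) = mmult N X (\<psi>\<psi> X w)))"

text \<open>The morphism is given by \<open>\<psi>\<close>, \<open>\<psi>'\<close>, \<open>\<psi>\<psi>\<close> and its inverse by \<open>\<theta>\<close>, \<open>\<theta>'\<close>, \<open>\<theta>\<theta>\<close>.\<close>

definition monad_isomorphism ::
  "('a, 'b, 'ea, 'eb, 'eea) monad_data \<Rightarrow> ('a, 'b, 'fa, 'fb, 'ffa) monad_data \<Rightarrow>
   ('a topology \<Rightarrow> 'ea \<Rightarrow> 'fa) \<Rightarrow> ('b topology \<Rightarrow> 'eb \<Rightarrow> 'fb) \<Rightarrow>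
   ('a topology \<Rightarrow> 'eea \<Rightarrow> 'ffa) \<Rightarrow>
   ('a topology \<Rightarrow> 'fa \<Rightarrow> 'ea) \<Rightarrow> ('b topology \<Rightarrow> 'fb \<Rightarrow> 'eb) \<Rightarrow>
   ('a topology \<Rightarrow> 'ffa \<Rightarrow> 'eea) \<Rightarrow> bool" where
  "monad_isomorphism M N \<psi> \<psi>' \<psi>\<psi> \<theta> \<theta>' \<theta>\<theta> \<longleftrightarrow>
     monad_morphism M N \<psi> \<psi>' \<psi>\<psi> \<and>
     monad_morphism N M \<theta> \<theta>' \<theta>\<theta> \<and>
     (\<forall>X. compactum X \<longrightarrow>
        (\<forall>z\<in>topspace (fobj M X). \<theta> X (\<psi> X z) = z) \<and>
        (\<forall>w\<in>topspace (fobj N X). \<psi> X (\<theta> X w) = w))"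


section \<open>Capacities and the possibility capacity monad\<close>

definition capacities :: "'a topology \<Rightarrow> ('a set \<Rightarrow> real) set" where
  "capacities X =
     {\<nu> \<in> {F. closedin X F} \<rightarrow>\<^sub>E {0..1}.
        \<nu> (topspace X) = 1 \<and> \<nu> {} = 0 \<and>
        (\<forall>F G. closedin X F \<and> closedin X G \<and> F \<subseteq> G \<longrightarrow> \<nu> F \<le> \<nu> G) \<and>
        (\<forall>F. \<forall>a\<in>{0..1}. closedin X F \<and> \<nu> F < a \<longrightarrow>
           (\<exists>U. openin X U \<and> F \<subseteq> U \<and> (\<forall>B. compactin X B \<and> B \<subseteq> U \<longrightarrow> \<nu> B < a)))}"

definition open_value :: "'a topology \<Rightarrow> ('a set \<Rightarrow> real) \<Rightarrow> 'a set \<Rightarrow> real" where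
  "open_value X \<nu> U = Sup {\<nu> K |K. closedin X K \<and> K \<subseteq> U}"

definition capacity_space :: "'a topology \<Rightarrow> ('a set \<Rightarrow> real) topology" where
  "capacity_space X = topology_generated_by
     ({{c \<in> capacities X. c F < a} |F a. closedin X F \<and> a \<in> {0..1}} \<union>
      {{c \<in> capacities X. open_value X c U > a} |U a. openin X U \<and> a \<in> {0..1}})"

text \<open>The empty family is excluded because \<open>Sup {}\<close> is unspecified on the reals; for it the condition
  would read \<open>\<nu> {} = 0\<close>.\<close>

definition possibilities :: "'a topology \<Rightarrow> ('a set \<Rightarrow> real) set" where
  "possibilities X =
     {\<nu> \<in> capacities X.
        \<forall>\<A>. \<A> \<noteq> {} \<and> (\<forall>A\<in>\<A>. closedin X A) \<and> closedin X (\<Union>\<A>) \<longrightarrow>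
          \<nu> (\<Union>\<A>) = (SUP A\<in>\<A>. \<nu> A)}"

definition Pi_space :: "'a topology \<Rightarrow> ('a set \<Rightarrow> real) topology" where
  "Pi_space X = subtopology (capacity_space X) (possibilities X)"

definition Pi_map ::
  "'a topology \<Rightarrow> 'b topology \<Rightarrow> ('a \<Rightarrow> 'b) \<Rightarrow> ('a set \<Rightarrow> real) \<Rightarrow> 'b set \<Rightarrow> real" where
  "Pi_map X Y f \<nu> = (\<lambda>A\<in>{A. closedin Y A}. \<nu> {x \<in> topspace X. f x \<in> A})"

definition Pi_unit :: "'a topology \<Rightarrow> 'a \<Rightarrow> 'a set \<Rightarrow> real" where
  "Pi_unit X x = (\<lambda>F\<in>{F. closedin X F}. if x \<in> F then 1 else 0)"

definition Pi_level :: "'a topology \<Rightarrow> 'a set \<Rightarrow> real \<Rightarrow> ('a set \<Rightarrow> real) set" where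
  "Pi_level X F t = {c \<in> possibilities X. c F \<ge> t}"

definition Pi_mult ::
  "(real \<Rightarrow> real \<Rightarrow> real) \<Rightarrow> 'a topology \<Rightarrow> (('a set \<Rightarrow> real) set \<Rightarrow> real) \<Rightarrow> 'a set \<Rightarrow> real" where
  "Pi_mult T X \<C> =
     (\<lambda>F\<in>{F. closedin X F}. maximum ((\<lambda>t. T (\<C> (Pi_level X F t)) t) ` {0<..1}))"

definition U_monad ::
  "(real \<Rightarrow> real \<Rightarrow> real) \<Rightarrow>
   ('a, 'b, 'a set \<Rightarrow> real, 'b set \<Rightarrow> real, ('a set \<Rightarrow> real) set \<Rightarrow> real) monad_data" where
  "U_monad T =
     \<lparr>fobj = Pi_space, fobj' = Pi_space, fobj2 = (\<lambda>X. Pi_space (Pi_space X)),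
      fmap = Pi_map, munit = Pi_unit, mmult = Pi_mult T\<rparr>"


section \<open>The monad of functionals\<close>

definition CI :: "'a topology \<Rightarrow> ('a \<Rightarrow> real) set" where
  "CI X = {\<phi> \<in> extensional (topspace X). continuous_map X (top_of_set {0..1}) \<phi>}"

definition A_set :: "(real \<Rightarrow> real \<Rightarrow> real) \<Rightarrow> 'a topology \<Rightarrow> (('a \<Rightarrow> real) \<Rightarrow> real) set" where
  "A_set T X =
     {\<mu> \<in> CI X \<rightarrow>\<^sub>E {0..1}.
        \<mu> (\<lambda>x\<in>topspace X. 1) = 1 \<and>
        (\<forall>\<psi>\<in>CI X. \<forall>\<phi>\<in>CI X. \<mu> (\<lambda>x\<in>topspace X. max (\<psi> x) (\<phi> x)) = max (\<mu> \<psi>) (\<mu> \<phi>)) \<and>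
        (\<forall>c\<in>{0..1}. \<forall>\<phi>\<in>CI X. \<mu> (\<lambda>x\<in>topspace X. T c (\<phi> x)) = T c (\<mu> \<phi>))}"

definition A_space ::
  "(real \<Rightarrow> real \<Rightarrow> real) \<Rightarrow> 'a topology \<Rightarrow> (('a \<Rightarrow> real) \<Rightarrow> real) topology" where
  "A_space T X = subtopology (product_topology (\<lambda>_. top_of_set {0..1}) (CI X)) (A_set T X)"

definition A_map ::
  "'a topology \<Rightarrow> 'b topology \<Rightarrow> ('a \<Rightarrow> 'b) \<Rightarrow> (('a \<Rightarrow> real) \<Rightarrow> real) \<Rightarrow> ('b \<Rightarrow> real) \<Rightarrow> real" where
  "A_map X Y f \<mu> = (\<lambda>\<phi>\<in>CI Y. \<mu> (\<lambda>x\<in>topspace X. \<phi> (f x)))"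

definition A_unit :: "'a topology \<Rightarrow> 'a \<Rightarrow> ('a \<Rightarrow> real) \<Rightarrow> real" where
  "A_unit X x = (\<lambda>\<phi>\<in>CI X. \<phi> x)"

definition A_mult ::
  "(real \<Rightarrow> real \<Rightarrow> real) \<Rightarrow> 'a topology \<Rightarrow> (((('a \<Rightarrow> real) \<Rightarrow> real) \<Rightarrow> real) \<Rightarrow> real) \<Rightarrow>
   ('a \<Rightarrow> real) \<Rightarrow> real" where
  "A_mult T X \<M> = (\<lambda>\<phi>\<in>CI X. \<M> (\<lambda>\<mu>\<in>topspace (A_space T X). \<mu> \<phi>))"

definition A_monad ::
  "(real \<Rightarrow> real \<Rightarrow> real) \<Rightarrow>
   ('a, 'b, ('a \<Rightarrow> real) \<Rightarrow> real, ('b \<Rightarrow> real) \<Rightarrow> real,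
    ((('a \<Rightarrow> real) \<Rightarrow> real) \<Rightarrow> real) \<Rightarrow> real) monad_data" where
  "A_monad T =
     \<lparr>fobj = A_space T, fobj' = A_space T, fobj2 = (\<lambda>X. A_space T (A_space T X)),
      fmap = A_map, munit = A_unit, mmult = A_mult T\<rparr>"


section \<open>The t-normed integral\<close>

definition tintegral ::
  "(real \<Rightarrow> real \<Rightarrow> real) \<Rightarrow> 'a topology \<Rightarrow> ('a set \<Rightarrow> real) \<Rightarrow> ('a \<Rightarrow> real) \<Rightarrow> real" where
  "tintegral T X \<nu> f = maximum ((\<lambda>t. T (\<nu> {x \<in> topspace X. f x \<in> {t..1}}) t) ` {0..1})"

definition l_map ::
  "(real \<Rightarrow> real \<Rightarrow> real) \<Rightarrow> 'a topology \<Rightarrow> ('a set \<Rightarrow> real) \<Rightarrow> ('a \<Rightarrow> real) \<Rightarrow> real" where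
  "l_map T X \<nu> = (\<lambda>\<phi>\<in>CI X. tintegral T X \<nu> \<phi>)"

text \<open>The only candidate for the inverse of \<open>l_map\<close>; it is named because the components at different
  types cannot be obtained from a single existential quantifier.\<close>

definition l_inv ::
  "(real \<Rightarrow> real \<Rightarrow> real) \<Rightarrow> 'a topology \<Rightarrow> (('a \<Rightarrow> real) \<Rightarrow> real) \<Rightarrow> 'a set \<Rightarrow> real" where
  "l_inv T X = inv_into (topspace (Pi_space X)) (l_map T X)"

end

theory Submission
  imports Defs
begin

text \<open>
  Let \<open>\<odot>\<close> be the t-norm.  A possibility capacity \<open>\<nu>\<close> on a compactum is the same thing as its density
  \<open>x \<mapsto> \<nu> {x}\<close>, which is upper semicontinuous with values in \<open>[0,1]\<close> and takes the value \<open>1\<close>: the value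
  of \<open>\<nu>\<close> on a nonempty closed set is the maximum of the density there, and outer regularity of \<open>\<nu>\<close> is
  upper semicontinuity of the density (\<open>density_capacity_possibility\<close>,
  \<open>possibility_point_unit_usc\<close>, \<open>possibility_SUP_points\<close>).  In these terms the t-normed integral is
  \<open>max\<^sub>x \<nu> {x} \<odot> \<phi> x\<close> (\<open>sup_integral_layers\<close>).  The multiplication of the monad of capacities is
  a maximum over level sets as well, namely of the evaluation \<open>c \<mapsto> c F\<close> on \<open>\<Pi> X\<close>, and so it is the integral
  of this upper semicontinuous function.

  The integral determines the capacity, because Urysohn functions give
  \<open>\<nu> F < a \<longleftrightarrow> (\<exists>\<phi>. \<phi> = 1 on F and \<integral>\<phi> d\<nu> < a)\<close> and a dual formula for open sets.  The same two formulas
  show that the inverse of \<open>l\<close> is continuous (\<open>possibility_less_iff_integral\<close>,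
  \<open>open_value_greater_iff_integral\<close>).  Conversely, a functional \<open>\<mu>\<close> is the integral against the
  capacity with density \<open>d x = inf {\<mu> \<psi> | \<psi> = 1 near x}\<close>.  That \<open>\<mu> \<phi>\<close> is at most
  \<open>max\<^sub>x d x \<odot> \<phi> x\<close> is a compactness argument which dominates \<open>\<phi>\<close> by a finite maximum of functions
  \<open>s \<odot> \<psi>\<close>; the other inequality uses Urysohn functions (\<open>functional_less_if_density_less\<close>,
  \<open>functional_density_tnorm_le\<close>).

  Hence \<open>l\<close> is a homeomorphism from \<open>\<Pi> X\<close> to \<open>A\<^sup>* X\<close>.  The latter is a closed subspace of a power of
  \<open>[0,1]\<close>, so that \<open>\<Pi> X\<close> is a compactum too, and integration over \<open>\<Pi> X\<close> falls under the same theory.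
  Naturality and the unit law hold by inspection of level sets and points.  The multiplication law is
  the interchange of two maxima, \<open>max\<^sub>x (max\<^sub>c w {c} \<odot> c {x}) \<odot> \<phi> x = max\<^sub>c w {c} \<odot> (max\<^sub>x c {x} \<odot> \<phi> x)\<close>
  (\<open>sup_integral_Pi_mult\<close>).  The laws for the inverse transformation follow from those for \<open>l\<close>, once
  \<open>\<Pi> f\<close>, the unit and the multiplication of capacities are known to produce possibility capacities.
\<close>

section \<open>Continuous t-norms\<close>

locale cont_tnorm =
  fixes T :: "real \<Rightarrow> real \<Rightarrow> real" (infixl "\<odot>" 70)
  assumes continuous_tnorm: "continuous_tnorm (\<odot>)"
begin

lemma tnorm_closed: "x \<in> {0..1} \<Longrightarrow> y \<in> {0..1} \<Longrightarrow> x \<odot> y \<in> {0..1}"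
  and tnorm_assoc: "x \<in> {0..1} \<Longrightarrow> y \<in> {0..1} \<Longrightarrow> z \<in> {0..1} \<Longrightarrow> x \<odot> y \<odot> z = x \<odot> (y \<odot> z)"
  and tnorm_commute: "x \<in> {0..1} \<Longrightarrow> y \<in> {0..1} \<Longrightarrow> x \<odot> y = y \<odot> x"
  and tnorm_mono: "x \<in> {0..1} \<Longrightarrow> x' \<in> {0..1} \<Longrightarrow> y \<in> {0..1} \<Longrightarrow> y' \<in> {0..1} \<Longrightarrow>
        x \<le> x' \<Longrightarrow> y \<le> y' \<Longrightarrow> x \<odot> y \<le> x' \<odot> y'"
  and tnorm_one_right: "x \<in> {0..1} \<Longrightarrow> x \<odot> 1 = x"
  and tnorm_continuous: "continuous_on ({0..1} \<times> {0..1}) (\<lambda>(x, y). x \<odot> y)"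
  using continuous_tnorm unfolding continuous_tnorm_def tnorm_def by blast+

lemma tnorm_one_left: "x \<in> {0..1} \<Longrightarrow> 1 \<odot> x = x"
  using tnorm_commute[of 1 x] tnorm_one_right[of x] by simp

lemma tnorm_zero_right: "x \<in> {0..1} \<Longrightarrow> x \<odot> 0 = 0"
  using tnorm_mono[of x 1 0 0] tnorm_one_left[of 0] tnorm_closed[of x 0] by force

lemma tnorm_zero_left: "x \<in> {0..1} \<Longrightarrow> 0 \<odot> x = 0"
  using tnorm_commute[of 0 x] tnorm_zero_right[of x] by simp

lemma tnorm_near:
  assumes "p \<in> {0..1}" "q \<in> {0..1}" "0 < d"
  obtains e where "0 < e"
    "\<And>p' q'. p' \<in> {0..1} \<Longrightarrow> q' \<in> {0..1} \<Longrightarrow> \<bar>p' - p\<bar> < e \<Longrightarrow> \<bar>q' - q\<bar> < e \<Longrightarrow>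
       \<bar>p' \<odot> q' - p \<odot> q\<bar> < d"
proof -
  obtain e where e: "0 < e"
    "\<And>w. w \<in> {0..1} \<times> {0..1} \<Longrightarrow> dist w (p, q) < e \<Longrightarrow>
       dist (case w of (x, y) \<Rightarrow> x \<odot> y) (case (p, q) of (x, y) \<Rightarrow> x \<odot> y) < d"
    using tnorm_continuous assms unfolding continuous_on_iff by (metis SigmaI)
  show thesis
  proof (rule that[of "e / 2"])
    fix p' q' :: real
    assume *: "p' \<in> {0..1}" "q' \<in> {0..1}" "\<bar>p' - p\<bar> < e / 2" "\<bar>q' - q\<bar> < e / 2"
    have "dist (p', q') (p, q) \<le> \<bar>p' - p\<bar> + \<bar>q' - q\<bar>"
      by (simp add: dist_Pair_Pair dist_real_def) (metis real_sqrt_abs sqrt_sum_squares_le_sum_abs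
          power2_abs)
    then show "\<bar>p' \<odot> q' - p \<odot> q\<bar> < d"
      using e(2)[of "(p', q')"] * by (auto simp: dist_real_def)
  qed (use e in auto)
qed

lemma tnorm_left_continuous_map:
  assumes "c \<in> {0..1}"
  shows "continuous_map (top_of_set {0..1}) euclideanreal (\<lambda>y. c \<odot> y)"
proof -
  have "continuous_on {0..1} (\<lambda>y. (\<lambda>(x, y). x \<odot> y) (c, y))"
    by (rule continuous_on_compose2[OF tnorm_continuous])
      (use assms in \<open>auto intro!: continuous_intros\<close>)
  then show ?thesis by simp
qed

text \<open>Continuity and monotonicity combined: the neighbourhood is unbounded below, so one may use it with
  upper bounds for the arguments that are not themselves close to \<open>p\<close> and \<open>q\<close>.\<close>

lemma tnorm_less_nearby:
  assumes p: "p \<in> {0..1}" and q: "q \<in> {0..1}" and "p \<odot> q < a"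
  obtains e where "0 < e"
    "\<And>p' q'. p' \<in> {0..1} \<Longrightarrow> q' \<in> {0..1} \<Longrightarrow> p' < p + e \<Longrightarrow> q' < q + e \<Longrightarrow> p' \<odot> q' < a"
proof -
  obtain e where e: "0 < e"
    "\<And>p' q'. p' \<in> {0..1} \<Longrightarrow> q' \<in> {0..1} \<Longrightarrow> \<bar>p' - p\<bar> < e \<Longrightarrow> \<bar>q' - q\<bar> < e \<Longrightarrow>
       \<bar>p' \<odot> q' - p \<odot> q\<bar> < a - p \<odot> q"
    using tnorm_near[OF p q, of "a - p \<odot> q"] assms(3) by auto
  show thesis
  proof (rule that[OF e(1)])
    fix p' q' :: real
    assume *: "p' \<in> {0..1}" "q' \<in> {0..1}" "p' < p + e" "q' < q + e"
    have "p' \<odot> q' \<le> max p p' \<odot> max q q'"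
      using * p q by (intro tnorm_mono) auto
    also have "\<dots> < a"
      using e(2)[of "max p p'" "max q q'"] * p q e(1) by (auto simp: abs_less_iff max_def)
    finally show "p' \<odot> q' < a" .
  qed
qed

lemma tnorm_greater_nearby:
  assumes p: "p \<in> {0..1}" and q: "q \<in> {0..1}" and "a < p \<odot> q"
  obtains e where "0 < e"
    "\<And>p' q'. p' \<in> {0..1} \<Longrightarrow> q' \<in> {0..1} \<Longrightarrow> p - e < p' \<Longrightarrow> q - e < q' \<Longrightarrow> a < p' \<odot> q'"
proof -
  obtain e where e: "0 < e"
    "\<And>p' q'. p' \<in> {0..1} \<Longrightarrow> q' \<in> {0..1} \<Longrightarrow> \<bar>p' - p\<bar> < e \<Longrightarrow> \<bar>q' - q\<bar> < e \<Longrightarrow>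
       \<bar>p' \<odot> q' - p \<odot> q\<bar> < p \<odot> q - a"
    using tnorm_near[OF p q, of "p \<odot> q - a"] assms(3) by auto
  show thesis
  proof (rule that[OF e(1)])
    fix p' q' :: real
    assume *: "p' \<in> {0..1}" "q' \<in> {0..1}" "p - e < p'" "q - e < q'"
    have "a < min p p' \<odot> min q q'"
      using e(2)[of "min p p'" "min q q'"] * p q e(1) by (auto simp: abs_less_iff min_def)
    also have "\<dots> \<le> p' \<odot> q'"
      using * p q by (intro tnorm_mono) auto
    finally show "a < p' \<odot> q'" .
  qed
qed

end

section \<open>Upper semicontinuous functions\<close>

definition upper_semicontinuous :: "'a topology \<Rightarrow> ('a \<Rightarrow> real) \<Rightarrow> bool" where
  "upper_semicontinuous X f \<longleftrightarrow> (\<forall>a. openin X {x \<in> topspace X. f x < a})"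

lemma upper_semicontinuous_openD:
  "upper_semicontinuous X f \<Longrightarrow> openin X {x \<in> topspace X. f x < a}"
  by (simp add: upper_semicontinuous_def)

lemma upper_semicontinuous_closedD:
  assumes "upper_semicontinuous X f"
  shows "closedin X {x \<in> topspace X. a \<le> f x}"
proof -
  have "topspace X - {x \<in> topspace X. a \<le> f x} = {x \<in> topspace X. f x < a}" by auto
  then show ?thesis using assms by (auto simp: closedin_def upper_semicontinuous_def)
qed

lemma upper_semicontinuousI_closed:
  assumes "\<And>a. closedin X {x \<in> topspace X. a \<le> f x}"
  shows "upper_semicontinuous X f"
  unfolding upper_semicontinuous_def
proof
  fix a
  have "{x \<in> topspace X. f x < a} = topspace X - {x \<in> topspace X. a \<le> f x}" by auto
  then show "openin X {x \<in> topspace X. f x < a}" using assms by auto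
qed

lemma upper_semicontinuousI_local:
  assumes "\<And>x a. x \<in> topspace X \<Longrightarrow> f x < a \<Longrightarrow>
             \<exists>U. openin X U \<and> x \<in> U \<and> (\<forall>y\<in>U. f y < a)"
  shows "upper_semicontinuous X f"
  unfolding upper_semicontinuous_def
proof
  fix a
  show "openin X {x \<in> topspace X. f x < a}"
  proof (subst openin_subopen, intro ballI)
    fix x assume "x \<in> {x \<in> topspace X. f x < a}"
    then obtain U where U: "openin X U" "x \<in> U" "\<forall>y\<in>U. f y < a" using assms by blast
    then have "U \<subseteq> {x \<in> topspace X. f x < a}" using openin_subset by blast
    then show "\<exists>U. openin X U \<and> x \<in> U \<and> U \<subseteq> {x \<in> topspace X. f x < a}" using U by blast
  qed
qed

lemma upper_semicontinuous_compose:
  assumes "upper_semicontinuous Y f" "continuous_map X Y g"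
  shows "upper_semicontinuous X (f \<circ> g)"
  unfolding upper_semicontinuous_def
proof
  fix a
  have "{x \<in> topspace X. (f \<circ> g) x < a} = {x \<in> topspace X. g x \<in> {y \<in> topspace Y. f y < a}}"
    using assms(2) by (auto simp: continuous_map_def)
  then show "openin X {x \<in> topspace X. (f \<circ> g) x < a}"
    using openin_continuous_map_preimage[OF assms(2) upper_semicontinuous_openD[OF assms(1)]]
    by simp
qed

lemma (in cont_tnorm) upper_semicontinuous_tnorm:
  assumes f: "upper_semicontinuous X f" "\<And>x. x \<in> topspace X \<Longrightarrow> f x \<in> {0..1}"
    and g: "upper_semicontinuous X g" "\<And>x. x \<in> topspace X \<Longrightarrow> g x \<in> {0..1}"
  shows "upper_semicontinuous X (\<lambda>x. f x \<odot> g x)"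
proof (rule upper_semicontinuousI_local)
  fix x a assume x: "x \<in> topspace X" "f x \<odot> g x < a"
  obtain e where e: "0 < e" "\<And>p' q'. p' \<in> {0..1} \<Longrightarrow> q' \<in> {0..1} \<Longrightarrow> p' < f x + e \<Longrightarrow>
      q' < g x + e \<Longrightarrow> p' \<odot> q' < a"
    using tnorm_less_nearby[OF f(2)[OF x(1)] g(2)[OF x(1)] x(2)] by blast
  show "\<exists>U. openin X U \<and> x \<in> U \<and> (\<forall>y\<in>U. f y \<odot> g y < a)"
    using x e f(2) g(2) upper_semicontinuous_openD[OF f(1), of "f x + e"]
      upper_semicontinuous_openD[OF g(1), of "g x + e"]
    by (intro exI[of _ "{y \<in> topspace X. f y < f x + e} \<inter> {y \<in> topspace X. g y < g x + e}"]) auto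
qed

text \<open>If no value were greatest, the open sets \<open>{f < f x}\<close> would cover the space; in a finite subcover
  the point with the greatest value is not covered.\<close>

lemma upper_semicontinuous_attains_max:
  assumes "compact_space X" "topspace X \<noteq> {}" "upper_semicontinuous X f"
  obtains (max) x where "x \<in> topspace X" "\<And>y. y \<in> topspace X \<Longrightarrow> f y \<le> f x"
proof (rule ccontr)
  assume "\<not> thesis"
  then have *: "\<exists>x\<in>topspace X. f y < f x" if "y \<in> topspace X" for y
    using that max[of y] by (meson not_le \<open>\<not> thesis\<close>)
  let ?U = "\<lambda>x. {y \<in> topspace X. f y < f x}"
  have "\<exists>\<F>. finite \<F> \<and> \<F> \<subseteq> ?U ` topspace X \<and> topspace X \<subseteq> \<Union>\<F>"
  proof -
    have "\<forall>U\<in>?U ` topspace X. openin X U"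
      using assms(3) by (auto simp: upper_semicontinuous_def)
    moreover have "topspace X \<subseteq> \<Union>(?U ` topspace X)" using * by auto
    ultimately show ?thesis using assms(1) unfolding compact_space_alt by meson
  qed
  then obtain \<F> where \<F>: "finite \<F>" "\<F> \<subseteq> ?U ` topspace X" "topspace X \<subseteq> \<Union>\<F>" by blast
  obtain I where "I \<subseteq> topspace X" "finite I" "\<F> = ?U ` I"
    using finite_subset_image[OF \<F>(1,2)] by blast
  with \<F> have I: "finite I" "I \<subseteq> topspace X" "topspace X \<subseteq> \<Union>(?U ` I)" by simp_all
  then have "I \<noteq> {}" using assms(2) by auto
  then obtain m where m: "m \<in> I" "\<forall>i\<in>I. f i \<le> f m"
    using Max_in[of "f ` I"] Max_ge[of "f ` I"] I(1) by fastforce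
  then show False using I by fastforce
qed

text \<open>The set \<open>{g \<ge> a}\<close> is the projection of \<open>{f \<ge> a}\<close> along the compact factor, and such projections are
  closed maps.  This lemma yields both the upper half of the continuity of the integral in the
  capacity and the upper semicontinuity of the density of \<open>Pi_mult\<close>.\<close>

lemma upper_semicontinuous_marginal:
  assumes "compact_space X" and f: "upper_semicontinuous (prod_topology X Y) f"
    and attained: "\<And>y. y \<in> topspace Y \<Longrightarrow> \<exists>x\<in>topspace X. g y = f (x, y)"
    and bound: "\<And>x y. x \<in> topspace X \<Longrightarrow> y \<in> topspace Y \<Longrightarrow> f (x, y) \<le> g y"
  shows "upper_semicontinuous Y g"
proof (rule upper_semicontinuousI_closed)
  fix a
  have "{y \<in> topspace Y. a \<le> g y} = snd ` {z \<in> topspace (prod_topology X Y). a \<le> f z}"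
  proof (intro equalityI subsetI)
    fix y assume "y \<in> {y \<in> topspace Y. a \<le> g y}"
    then obtain x where "x \<in> topspace X" "y \<in> topspace Y" "a \<le> f (x, y)"
      using attained[of y] by auto
    then show "y \<in> snd ` {z \<in> topspace (prod_topology X Y). a \<le> f z}" by force
  next
    fix y assume "y \<in> snd ` {z \<in> topspace (prod_topology X Y). a \<le> f z}"
    then show "y \<in> {y \<in> topspace Y. a \<le> g y}" using bound by force
  qed
  then show "closedin Y {y \<in> topspace Y. a \<le> g y}"
    using closed_map_snd[OF assms(1)] upper_semicontinuous_closedD[OF f]
    unfolding closed_map_def by metis
qed

section \<open>Continuous functions into the unit interval\<close>

lemma CI_iff:
  "\<phi> \<in> CI X \<longleftrightarrow> \<phi> \<in> extensional (topspace X) \<and> continuous_map X euclideanreal \<phi> \<and>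
     (\<forall>x\<in>topspace X. \<phi> x \<in> {0..1})"
  unfolding CI_def by (auto simp: continuous_map_in_subtopology image_subset_iff)

lemma CI_range: "\<phi> \<in> CI X \<Longrightarrow> x \<in> topspace X \<Longrightarrow> \<phi> x \<in> {0..1}"
  by (simp add: CI_iff)

lemma CI_ext:
  "\<phi> \<in> CI X \<Longrightarrow> \<psi> \<in> CI X \<Longrightarrow> (\<And>x. x \<in> topspace X \<Longrightarrow> \<phi> x = \<psi> x) \<Longrightarrow> \<phi> = \<psi>"
  unfolding CI_iff by (auto intro: extensionalityI)

lemma CI_restrict:
  assumes "continuous_map X euclideanreal f" "\<And>x. x \<in> topspace X \<Longrightarrow> f x \<in> {0..1}"
  shows "(\<lambda>x\<in>topspace X. f x) \<in> CI X"
  unfolding CI_iff using assms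
  by (auto intro: continuous_map_eq)

lemma CI_const: "c \<in> {0..1} \<Longrightarrow> (\<lambda>x\<in>topspace X. c) \<in> CI X"
  by (rule CI_restrict) auto

lemma CI_nonempty: "CI X \<noteq> {}"
  using CI_const[of 0 X] by auto

lemma CI_max: "\<phi> \<in> CI X \<Longrightarrow> \<psi> \<in> CI X \<Longrightarrow> (\<lambda>x\<in>topspace X. max (\<phi> x) (\<psi> x)) \<in> CI X"
  by (rule CI_restrict) (auto simp: CI_iff continuous_map_real_max le_max_iff_disj)

lemma CI_compose:
  assumes "continuous_map X Y f" "\<phi> \<in> CI Y"
  shows "(\<lambda>x\<in>topspace X. \<phi> (f x)) \<in> CI X"
proof (rule CI_restrict)
  show "continuous_map X euclideanreal (\<lambda>x. \<phi> (f x))"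
    using continuous_map_compose[OF assms(1)] assms(2) by (force simp: CI_iff o_def)
  show "\<phi> (f x) \<in> {0..1}" if "x \<in> topspace X" for x
    using assms that by (auto simp: CI_iff continuous_map_def)
qed

lemma (in cont_tnorm) CI_tnorm:
  assumes c: "c \<in> {0..1}" and \<phi>: "\<phi> \<in> CI X"
  shows "(\<lambda>x\<in>topspace X. c \<odot> \<phi> x) \<in> CI X"
proof (rule CI_restrict)
  show "continuous_map X euclideanreal (\<lambda>x. c \<odot> \<phi> x)"
    using continuous_map_compose[OF _ tnorm_left_continuous_map[OF c], of X \<phi>] \<phi>
    by (simp add: CI_def o_def)
qed (use CI_range[OF \<phi>] c tnorm_closed in auto)

lemma CI_upper_semicontinuous: "\<phi> \<in> CI X \<Longrightarrow> upper_semicontinuous X \<phi>"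
  unfolding CI_iff upper_semicontinuous_def continuous_map_upper_lower_semicontinuous_lt by auto

lemma CI_open_greater: "\<phi> \<in> CI X \<Longrightarrow> openin X {x \<in> topspace X. a < \<phi> x}"
  unfolding CI_iff continuous_map_upper_lower_semicontinuous_lt by auto

lemma compactum_normal: "compactum X \<Longrightarrow> normal_space X"
  unfolding compactum_def by (auto intro: compact_Hausdorff_or_regular_imp_normal_space)

lemma compactum_closed_singleton: "compactum X \<Longrightarrow> x \<in> topspace X \<Longrightarrow> closedin X {x}"
  unfolding compactum_def by (simp add: closedin_Hausdorff_singleton)

lemma CI_Urysohn:
  assumes "compactum X" "closedin X F" "openin X U" "F \<subseteq> U"
  obtains \<phi> where "\<phi> \<in> CI X" "\<And>x. x \<in> F \<Longrightarrow> \<phi> x = 1" "\<And>x. x \<in> topspace X \<Longrightarrow> x \<notin> U \<Longrightarrow> \<phi> x = 0"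
proof -
  have "disjnt (topspace X - U) F" "closedin X (topspace X - U)"
    using assms by (auto simp: disjnt_def)
  then obtain f where f: "continuous_map X (top_of_set {0..1::real}) f" "f ` (topspace X - U) \<subseteq> {0}"
    "f ` F \<subseteq> {1}"
    using Urysohn_lemma[OF compactum_normal[OF assms(1)] _ assms(2), of "topspace X - U" 0 1]
    by (metis zero_le_one)
  have "F \<subseteq> topspace X" using assms closedin_subset by auto
  with f show thesis
    by (intro that[of "restrict f (topspace X)"])
      (auto intro!: CI_restrict simp: continuous_map_in_subtopology image_subset_iff)
qed

section \<open>Possibility capacities and their densities\<close>

definition unit_usc :: "'a topology \<Rightarrow> ('a \<Rightarrow> real) \<Rightarrow> bool" where
  "unit_usc X f \<longleftrightarrow> upper_semicontinuous X f \<and> (\<forall>x\<in>topspace X. f x \<in> {0..1})"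

lemma CI_unit_usc: "\<phi> \<in> CI X \<Longrightarrow> unit_usc X \<phi>"
  unfolding unit_usc_def by (intro conjI ballI CI_upper_semicontinuous; (rule CI_range)?)

definition density :: "'a topology \<Rightarrow> ('a \<Rightarrow> real) \<Rightarrow> bool" where
  "density X d \<longleftrightarrow> unit_usc X d \<and> (\<exists>x\<in>topspace X. d x = 1)"

text \<open>The case distinction is needed because \<^const>\<open>Sup\<close> of the empty set of reals is unspecified.\<close>

definition density_capacity :: "'a topology \<Rightarrow> ('a \<Rightarrow> real) \<Rightarrow> 'a set \<Rightarrow> real" where
  "density_capacity X d = (\<lambda>F\<in>{F. closedin X F}. if F = {} then 0 else SUP x\<in>F. d x)"

lemma compactin_iff_closedin: "compactum X \<Longrightarrow> compactin X F \<longleftrightarrow> closedin X F"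
  unfolding compactum_def using closedin_compact_space compactin_imp_closedin by blast

lemma upper_semicontinuous_attains_max_on:
  assumes "compactum X" "upper_semicontinuous X f" "closedin X F" "F \<noteq> {}"
  obtains x where "x \<in> F" "\<And>y. y \<in> F \<Longrightarrow> f y \<le> f x"
proof -
  have F: "topspace (subtopology X F) = F" using closedin_subset[OF assms(3)] by auto
  have "compact_space (subtopology X F)"
    using assms compactin_iff_closedin compactin_subspace by blast
  moreover have "upper_semicontinuous (subtopology X F) (f \<circ> id)"
    by (rule upper_semicontinuous_compose[OF assms(2)]) (simp add: continuous_map_from_subtopology)
  ultimately show thesis
    using upper_semicontinuous_attains_max[of "subtopology X F" f] that assms(4)
    unfolding F by auto
qed

lemma density_capacity_attained:
  assumes "compactum X" "density X d" "closedin X F" "F \<noteq> {}"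
  obtains x where "x \<in> F" "density_capacity X d F = d x" "\<And>y. y \<in> F \<Longrightarrow> d y \<le> d x"
proof -
  obtain x where x: "x \<in> F" "\<And>y. y \<in> F \<Longrightarrow> d y \<le> d x"
    using upper_semicontinuous_attains_max_on assms unfolding density_def unit_usc_def by metis
  moreover have "(SUP x\<in>F. d x) = d x"
    using x by (intro cSup_eq_maximum) auto
  ultimately show thesis using that assms by (simp add: density_capacity_def)
qed

lemma density_capacity_singleton:
  assumes "compactum X" "x \<in> topspace X"
  shows "density_capacity X d {x} = d x"
  using compactum_closed_singleton[OF assms] by (simp add: density_capacity_def)

text \<open>Everything reduces to the fact that the supremum over a nonempty closed set is attained.  For
  outer regularity at \<open>F\<close> the open set \<open>{d < a}\<close> contains \<open>F\<close>, and on closed \<open>B\<close> inside it the maximum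
  is less than \<open>a\<close>.\<close>

lemma density_capacity_possibility:
  assumes X: "compactum X" and d: "density X d"
  shows "density_capacity X d \<in> possibilities X"
proof -
  let ?\<nu> = "density_capacity X d"
  have att: "\<exists>x\<in>F. ?\<nu> F = d x \<and> (\<forall>y\<in>F. d y \<le> d x)" if "closedin X F" "F \<noteq> {}" for F
    by (rule density_capacity_attained[OF X d that]) blast
  have range: "d x \<in> {0..1}" if "x \<in> topspace X" for x
    using d that by (auto simp: density_def unit_usc_def)
  have empty: "?\<nu> {} = 0" by (simp add: density_capacity_def)
  have \<nu>_range: "?\<nu> F \<in> {0..1}" if "closedin X F" for F
  proof (cases "F = {}")
    case False
    then show ?thesis using att[OF that] range closedin_subset[OF that] by fastforce
  qed (simp add: empty)
  have upper: "d x \<le> ?\<nu> F" if "closedin X F" "x \<in> F" for F x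
    using att[OF that(1)] that(2) by fastforce
  have mono: "?\<nu> F \<le> ?\<nu> G" if "closedin X F" "closedin X G" "F \<subseteq> G" for F G
  proof (cases "F = {}")
    case False
    then show ?thesis using att[OF that(1)] upper[OF that(2)] that(3) by fastforce
  qed (use \<nu>_range[OF that(2)] empty in auto)
  have top: "?\<nu> (topspace X) = 1"
    using upper[of "topspace X"] \<nu>_range[of "topspace X"] d by (force simp: density_def)
  have "\<exists>U. openin X U \<and> F \<subseteq> U \<and> (\<forall>B. compactin X B \<and> B \<subseteq> U \<longrightarrow> ?\<nu> B < a)"
    if F: "closedin X F" "?\<nu> F < a" for F a
  proof (intro exI conjI allI impI)
    have "0 < a" using \<nu>_range[OF F(1)] F(2) by auto
    show "openin X {x \<in> topspace X. d x < a}"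
      using d by (simp add: density_def unit_usc_def upper_semicontinuous_def)
    show "F \<subseteq> {x \<in> topspace X. d x < a}"
      using upper[OF F(1)] F closedin_subset by fastforce
    fix B assume B: "compactin X B \<and> B \<subseteq> {x \<in> topspace X. d x < a}"
    then have "closedin X B" using X compactin_iff_closedin by blast
    then show "?\<nu> B < a"
      using att[of B] B empty \<open>0 < a\<close> by (cases "B = {}") fastforce+
  qed
  then have cap: "?\<nu> \<in> capacities X"
    unfolding capacities_def using \<nu>_range mono top empty
    by (auto simp: density_capacity_def)
  have "?\<nu> (\<Union>\<A>) = (SUP A\<in>\<A>. ?\<nu> A)"
    if \<A>: "\<A> \<noteq> {}" "\<And>A. A \<in> \<A> \<Longrightarrow> closedin X A" "closedin X (\<Union>\<A>)" for \<A>
  proof -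
    have "\<exists>A\<in>\<A>. ?\<nu> (\<Union>\<A>) = ?\<nu> A"
    proof (cases "\<Union>\<A> = {}")
      case True
      then show ?thesis using \<A>(1) by (metis Sup_bot_conv(1) all_not_in_conv)
    next
      case False
      then obtain x A where x: "x \<in> A" "A \<in> \<A>" "?\<nu> (\<Union>\<A>) = d x"
        using att[OF \<A>(3)] by auto
      then have "?\<nu> A \<le> ?\<nu> (\<Union>\<A>)" using \<A> by (intro mono) auto
      then show ?thesis
        using upper[OF \<A>(2)[OF x(2)] x(1)] x by (intro bexI[of _ A]) auto
    qed
    then show ?thesis
      using mono[OF \<A>(2) \<A>(3)] by (intro cSup_eq_maximum[symmetric]) auto
  qed
  with cap show ?thesis by (simp add: possibilities_def)
qed

lemma possibility_range: "\<nu> \<in> possibilities X \<Longrightarrow> closedin X F \<Longrightarrow> \<nu> F \<in> {0..1}"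
  unfolding possibilities_def capacities_def by (blast dest: PiE_mem)

lemma possibility_empty: "\<nu> \<in> possibilities X \<Longrightarrow> \<nu> {} = 0"
  by (simp add: possibilities_def capacities_def)

lemma possibility_mono:
  "\<nu> \<in> possibilities X \<Longrightarrow> closedin X F \<Longrightarrow> closedin X G \<Longrightarrow> F \<subseteq> G \<Longrightarrow> \<nu> F \<le> \<nu> G"
  by (simp add: possibilities_def capacities_def)

lemma possibility_outer_regular:
  assumes "\<nu> \<in> possibilities X" "closedin X F" "\<nu> F < a" "a \<le> 1"
  obtains U where "openin X U" "F \<subseteq> U" "\<And>B. compactin X B \<Longrightarrow> B \<subseteq> U \<Longrightarrow> \<nu> B < a"
proof -
  have "a \<in> {0..1}" using possibility_range[OF assms(1,2)] assms(3,4) by auto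
  moreover have outer: "\<forall>F. \<forall>a\<in>{0..1}. closedin X F \<and> \<nu> F < a \<longrightarrow>
      (\<exists>U. openin X U \<and> F \<subseteq> U \<and> (\<forall>B. compactin X B \<and> B \<subseteq> U \<longrightarrow> \<nu> B < a))"
    using assms(1) by (simp add: possibilities_def capacities_def)
  ultimately have "\<exists>U. openin X U \<and> F \<subseteq> U \<and> (\<forall>B. compactin X B \<and> B \<subseteq> U \<longrightarrow> \<nu> B < a)"
    using outer[rule_format, of a F] assms(2,3) by simp
  then obtain U where "openin X U" "F \<subseteq> U" "\<forall>B. compactin X B \<and> B \<subseteq> U \<longrightarrow> \<nu> B < a"
    by (elim exE conjE)
  then show thesis by (intro that) blast+
qed

lemma possibility_topspace: "\<nu> \<in> possibilities X \<Longrightarrow> \<nu> (topspace X) = 1"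
  by (simp add: possibilities_def capacities_def)

lemma possibility_topspace_nonempty: "\<nu> \<in> possibilities X \<Longrightarrow> topspace X \<noteq> {}"
  using possibility_topspace[of \<nu> X] possibility_empty[of \<nu> X] by (cases "topspace X = {}") auto

lemma possibility_point_range:
  "compactum X \<Longrightarrow> \<nu> \<in> possibilities X \<Longrightarrow> x \<in> topspace X \<Longrightarrow> \<nu> {x} \<in> {0..1}"
  by (rule possibility_range[OF _ compactum_closed_singleton])

lemma possibility_point_le:
  assumes X: "compactum X" and \<nu>: "\<nu> \<in> possibilities X" and F: "closedin X F" "x \<in> F"
  shows "\<nu> {x} \<le> \<nu> F"
  using F compactum_closed_singleton[OF X] closedin_subset[OF F(1)]
  by (intro possibility_mono[OF \<nu>]) auto

text \<open>A closed set is the union of its points, and these are closed, so maxitivity over infinite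
  families applies.\<close>

lemma possibility_SUP_points:
  assumes X: "compactum X" and \<nu>: "\<nu> \<in> possibilities X" and F: "closedin X F" "F \<noteq> {}"
  shows "\<nu> F = (SUP x\<in>F. \<nu> {x})"
proof -
  have "\<forall>A\<in>(\<lambda>x. {x}) ` F. closedin X A"
    using compactum_closed_singleton[OF X] closedin_subset[OF F(1)] by auto
  moreover have "\<Union>((\<lambda>x. {x}) ` F) = F" by auto
  ultimately have "\<nu> (\<Union>((\<lambda>x. {x}) ` F)) = (SUP A\<in>(\<lambda>x. {x}) ` F. \<nu> A)"
    using \<nu> F unfolding possibilities_def by (smt (verit) image_is_empty mem_Collect_eq)
  then show ?thesis by (simp add: image_image)
qed

lemma possibility_point_unit_usc:
  assumes X: "compactum X" and \<nu>: "\<nu> \<in> possibilities X"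
  shows "unit_usc X (\<lambda>x. \<nu> {x})"
  unfolding unit_usc_def
proof (intro conjI ballI upper_semicontinuousI_local)
  fix x a assume x: "x \<in> topspace X" "\<nu> {x} < a"
  show "\<exists>U. openin X U \<and> x \<in> U \<and> (\<forall>y\<in>U. \<nu> {y} < a)"
  proof (cases "a \<le> 1")
    case True
    obtain U where "openin X U" "{x} \<subseteq> U" "\<And>B. compactin X B \<Longrightarrow> B \<subseteq> U \<Longrightarrow> \<nu> B < a"
      using possibility_outer_regular[OF \<nu> compactum_closed_singleton[OF X x(1)] x(2) True] by blast
    then show ?thesis
      by (meson compactin_sing insert_subset empty_subsetI openin_subset subsetD)
  next
    case False
    then show ?thesis
      using x possibility_point_range[OF X \<nu>] by (intro exI[of _ "topspace X"]) fastforce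
  qed
qed (use possibility_point_range[OF X \<nu>] in blast)

lemma possibility_attained:
  assumes X: "compactum X" and \<nu>: "\<nu> \<in> possibilities X" and F: "closedin X F" "F \<noteq> {}"
  obtains x where "x \<in> F" "\<nu> F = \<nu> {x}"
proof -
  obtain x where x: "x \<in> F" "\<And>y. y \<in> F \<Longrightarrow> \<nu> {y} \<le> \<nu> {x}"
    using upper_semicontinuous_attains_max_on[OF X _ F] possibility_point_unit_usc[OF X \<nu>]
    unfolding unit_usc_def by metis
  then have "(SUP x\<in>F. \<nu> {x}) = \<nu> {x}" by (intro cSup_eq_maximum) auto
  then show thesis using that x possibility_SUP_points[OF assms] by simp
qed

lemma possibility_point_one:
  assumes "compactum X" "\<nu> \<in> possibilities X"
  obtains x where "x \<in> topspace X" "\<nu> {x} = 1"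
proof -
  have "\<nu> (topspace X) = 1" using assms(2) by (rule possibility_topspace)
  then show thesis
    using possibility_attained[OF assms closedin_topspace possibility_topspace_nonempty[OF assms(2)]]
      that by metis
qed

lemma possibility_eqI:
  assumes X: "compactum X" and \<nu>: "\<nu> \<in> possibilities X" and \<nu>': "\<nu>' \<in> possibilities X"
    and eq: "\<And>x. x \<in> topspace X \<Longrightarrow> \<nu> {x} = \<nu>' {x}"
  shows "\<nu> = \<nu>'"
proof (rule extensionalityI)
  show "\<nu> \<in> extensional {F. closedin X F}" "\<nu>' \<in> extensional {F. closedin X F}"
    using \<nu> \<nu>' unfolding possibilities_def capacities_def PiE_def by blast+
  fix F assume "F \<in> {F. closedin X F}"
  then have F: "closedin X F" by simp
  show "\<nu> F = \<nu>' F"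
  proof (cases "F = {}")
    case False
    have "(SUP x\<in>F. \<nu> {x}) = (SUP x\<in>F. \<nu>' {x})"
      using eq closedin_subset[OF F] by (intro SUP_cong) auto
    then show ?thesis
      using possibility_SUP_points[OF X \<nu> F False] possibility_SUP_points[OF X \<nu>' F False] by simp
  qed (simp add: possibility_empty[OF \<nu>] possibility_empty[OF \<nu>'])
qed

section \<open>The topology of the space of possibility capacities\<close>

lemma topspace_capacity_space: "topspace (capacity_space X) = capacities X"
proof -
  have "capacities X \<subseteq> topspace (capacity_space X)"
  proof
    fix c assume c: "c \<in> capacities X"
    then have "c \<in> {c \<in> capacities X. c {} < 1}" by (simp add: capacities_def)
    moreover have "{c \<in> capacities X. c {} < 1} \<in> {{c \<in> capacities X. c F < a} |F a. closedin X F \<and> a \<in> {0..1}}"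
      by force
    ultimately show "c \<in> topspace (capacity_space X)"
      unfolding capacity_space_def topology_generated_by_topspace by blast
  qed
  then show ?thesis
    unfolding capacity_space_def topology_generated_by_topspace by blast
qed

lemma topspace_Pi_space: "topspace (Pi_space X) = possibilities X"
  unfolding Pi_space_def topspace_subtopology topspace_capacity_space by (auto simp: possibilities_def)

lemma Pi_space_eval_upper_semicontinuous:
  assumes F: "closedin X F"
  shows "unit_usc (Pi_space X) (\<lambda>c. c F)"
  unfolding unit_usc_def upper_semicontinuous_def topspace_Pi_space
proof (intro conjI allI ballI)
  fix a :: real
  consider "a < 0" | "a \<in> {0..1}" | "1 < a" by force
  then show "openin (Pi_space X) {c \<in> possibilities X. c F < a}"
  proof cases
    case 2
    then have "openin (capacity_space X) {c \<in> capacities X. c F < a}"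
      unfolding capacity_space_def using F by (intro topology_generated_by_Basis) blast
    then have "openin (Pi_space X) (possibilities X \<inter> {c \<in> capacities X. c F < a})"
      unfolding Pi_space_def by (simp add: openin_subtopology_Int2)
    moreover have "possibilities X \<inter> {c \<in> capacities X. c F < a} = {c \<in> possibilities X. c F < a}"
      by (auto simp: possibilities_def)
    ultimately show ?thesis by simp
  next
    case 1
    then have "{c \<in> possibilities X. c F < a} = {}" using possibility_range[OF _ F] by fastforce
    then show ?thesis by (simp only: openin_empty)
  next
    case 3
    then have "{c \<in> possibilities X. c F < a} = topspace (Pi_space X)"
      unfolding topspace_Pi_space using possibility_range[OF _ F] by fastforce
    then show ?thesis by (simp only: openin_topspace)
  qed
qed (use possibility_range[OF _ F] in blast)

lemma open_value_greater_iff: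
  assumes "\<nu> \<in> possibilities X"
  shows "a < open_value X \<nu> U \<longleftrightarrow> (\<exists>K. closedin X K \<and> K \<subseteq> U \<and> a < \<nu> K)"
proof -
  have "bdd_above {\<nu> K |K. closedin X K \<and> K \<subseteq> U}"
    using possibility_range[OF assms] by (intro bdd_aboveI[of _ 1]) auto
  moreover have "{\<nu> K |K. closedin X K \<and> K \<subseteq> U} \<noteq> {}" by (auto intro: exI[of _ "{}"])
  ultimately show ?thesis unfolding open_value_def by (subst less_cSup_iff) auto
qed

lemma Pi_space_open_value_open:
  assumes "openin X U" "a \<in> {0..1}"
  shows "openin (Pi_space X) {c \<in> possibilities X. a < open_value X c U}"
proof -
  have "openin (capacity_space X) {c \<in> capacities X. a < open_value X c U}"
    unfolding capacity_space_def using assms by (intro topology_generated_by_Basis) blast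
  then have "openin (Pi_space X) (possibilities X \<inter> {c \<in> capacities X. a < open_value X c U})"
    unfolding Pi_space_def by (simp add: openin_subtopology_Int2)
  moreover have "possibilities X \<inter> {c \<in> capacities X. a < open_value X c U} = {c \<in> possibilities X. a < open_value X c U}"
    by (auto simp: possibilities_def)
  ultimately show ?thesis by simp
qed

text \<open>If \<open>c {x} < a\<close>, outer regularity and normality give a closed neighbourhood \<open>K\<close> of \<open>x\<close> with
  \<open>c K < a\<close>.  The condition \<open>c' K < a\<close> is open in \<open>c'\<close> and bounds \<open>c'\<close> at all points of \<open>K\<close>.\<close>

lemma density_jointly_upper_semicontinuous:
  assumes X: "compactum X"
  shows "upper_semicontinuous (prod_topology X (Pi_space X)) (\<lambda>(x, c). c {x})"
proof (rule upper_semicontinuousI_local)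
  fix z :: "'a \<times> ('a set \<Rightarrow> real)" and a
  obtain x c where z: "z = (x, c)" by fastforce
  assume "z \<in> topspace (prod_topology X (Pi_space X))" "(case z of (x, c) \<Rightarrow> c {x}) < a"
  then have x: "x \<in> topspace X" and c: "c \<in> possibilities X" and less: "c {x} < a"
    by (auto simp: z topspace_Pi_space)
  show "\<exists>W. openin (prod_topology X (Pi_space X)) W \<and> z \<in> W \<and> (\<forall>w\<in>W. (case w of (x, c) \<Rightarrow> c {x}) < a)"
  proof (cases "a \<le> 1")
    case True
    obtain U where U: "openin X U" "{x} \<subseteq> U" "\<And>B. compactin X B \<Longrightarrow> B \<subseteq> U \<Longrightarrow> c B < a"
      using possibility_outer_regular[OF c compactum_closed_singleton[OF X x] less True] by blast
    obtain V where V: "openin X V" "{x} \<subseteq> V" "X closure_of V \<subseteq> U"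
      using compactum_normal[OF X] U compactum_closed_singleton[OF X x] unfolding normal_space_alt
      by meson
    let ?N = "{c \<in> possibilities X. c (X closure_of V) < a}"
    have "openin (Pi_space X) ?N"
      using Pi_space_eval_upper_semicontinuous[of X "X closure_of V"]
      by (simp add: unit_usc_def upper_semicontinuous_def topspace_Pi_space)
    moreover have "c (X closure_of V) < a"
      using U(3)[OF _ V(3)] compactin_iff_closedin[OF X] by simp
    moreover have "c' {y} < a" if "y \<in> V" "c' \<in> ?N" for y c'
      using possibility_point_le[OF X, of c' "X closure_of V" y] that
        closure_of_subset[OF openin_subset[OF V(1)]] by fastforce
    ultimately show ?thesis
      using V c by (intro exI[of _ "V \<times> ?N"]) (auto simp: z openin_prod_Times_iff)
  next
    case False
    have "c' {y} < a" if "y \<in> topspace X" "c' \<in> possibilities X" for y c'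
      using possibility_point_range[OF X that(2,1)] False by auto
    then show ?thesis
      using x c
      by (intro exI[of _ "topspace (prod_topology X (Pi_space X))"])
        (simp only: openin_topspace z, simp add: topspace_Pi_space)
  qed
qed

section \<open>Integrals against a density\<close>

lemma maximum_eqI: "z \<in> S \<Longrightarrow> (\<And>x. x \<in> S \<Longrightarrow> x \<le> z) \<Longrightarrow> maximum S = z"
  unfolding maximum_def by (rule Greatest_equality)

context cont_tnorm
begin

definition sup_integral :: "'a topology \<Rightarrow> ('a set \<Rightarrow> real) \<Rightarrow> ('a \<Rightarrow> real) \<Rightarrow> real" where
  "sup_integral X \<nu> f = (SUP x\<in>topspace X. \<nu> {x} \<odot> f x)"

text \<open>The supremum is a maximum since a t-norm of upper semicontinuous functions is upper
  semicontinuous.\<close>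

lemma sup_integral_attained_upper:
  assumes X: "compactum X" and \<nu>: "\<nu> \<in> possibilities X" and f: "unit_usc X f"
  obtains x where "x \<in> topspace X" "sup_integral X \<nu> f = \<nu> {x} \<odot> f x"
    "\<And>y. y \<in> topspace X \<Longrightarrow> \<nu> {y} \<odot> f y \<le> \<nu> {x} \<odot> f x"
proof -
  have usc: "upper_semicontinuous X (\<lambda>x. \<nu> {x} \<odot> f x)"
    using possibility_point_unit_usc[OF X \<nu>] f unfolding unit_usc_def
    by (intro upper_semicontinuous_tnorm) auto
  have "compact_space X" using X by (simp add: compactum_def)
  then obtain x where x: "x \<in> topspace X"
    "\<And>y. y \<in> topspace X \<Longrightarrow> \<nu> {y} \<odot> f y \<le> \<nu> {x} \<odot> f x"
    using upper_semicontinuous_attains_max[OF _ possibility_topspace_nonempty[OF \<nu>] usc] by blast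
  then have "sup_integral X \<nu> f = \<nu> {x} \<odot> f x"
    unfolding sup_integral_def by (intro cSup_eq_maximum) auto
  then show thesis using that x by blast
qed

lemma sup_integral_attained:
  assumes "compactum X" "\<nu> \<in> possibilities X" "unit_usc X f"
  obtains x where "x \<in> topspace X" "sup_integral X \<nu> f = \<nu> {x} \<odot> f x"
  using sup_integral_attained_upper[OF assms] that by blast

lemma sup_integral_upper:
  assumes "compactum X" "\<nu> \<in> possibilities X" "unit_usc X f" "x \<in> topspace X"
  shows "\<nu> {x} \<odot> f x \<le> sup_integral X \<nu> f"
  using sup_integral_attained_upper[OF assms(1-3)] assms(4) by metis

lemma sup_integral_range:
  assumes "compactum X" "\<nu> \<in> possibilities X" "unit_usc X f"
  shows "sup_integral X \<nu> f \<in> {0..1}"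
  using sup_integral_attained[OF assms] possibility_point_range[OF assms(1,2)] assms(3) tnorm_closed
  unfolding unit_usc_def by metis

text \<open>The value \<open>\<nu> {f \<ge> t}\<close> is \<open>\<nu> {y}\<close> for some \<open>y\<close> with \<open>f y \<ge> t\<close>, so each layer is at most
  \<open>\<nu> {y} \<odot> f y\<close>; the layer at \<open>t = f x\<close>, for \<open>x\<close> where the integral is attained, reaches it.  The index
  set \<open>S\<close> is kept general because \<open>tintegral\<close> uses \<open>[0,1]\<close> and \<open>Pi_mult\<close> uses \<open>(0,1]\<close>.\<close>

lemma sup_integral_layers:
  assumes X: "compactum X" and \<nu>: "\<nu> \<in> possibilities X" and f: "unit_usc X f"
    and S: "{0<..1} \<subseteq> S" "S \<subseteq> {0..1}"
  shows "maximum ((\<lambda>t. \<nu> {x \<in> topspace X. t \<le> f x} \<odot> t) ` S) = sup_integral X \<nu> f"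
proof -
  obtain x where x: "x \<in> topspace X" "sup_integral X \<nu> f = \<nu> {x} \<odot> f x"
    using sup_integral_attained[OF X \<nu> f] by blast
  note upper = sup_integral_upper[OF X \<nu> f]
  have closed: "closedin X {x \<in> topspace X. t \<le> f x}" for t
    using f by (simp add: unit_usc_def upper_semicontinuous_closedD)
  have fx: "f y \<in> {0..1}" if "y \<in> topspace X" for y using f that by (simp add: unit_usc_def)
  note \<nu>_range = possibility_range[OF \<nu> closed]
  have le: "\<nu> {x \<in> topspace X. t \<le> f x} \<odot> t \<le> sup_integral X \<nu> f" if t: "t \<in> {0..1}" for t
  proof (cases "{x \<in> topspace X. t \<le> f x} = {}")
    case True
    then show ?thesis
      unfolding True using sup_integral_range[OF X \<nu> f] possibility_empty[OF \<nu>] tnorm_zero_left[OF t]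
      by simp
  next
    case False
    then obtain y where y: "y \<in> topspace X" "t \<le> f y" "\<nu> {x \<in> topspace X. t \<le> f x} = \<nu> {y}"
      using possibility_attained[OF X \<nu> closed] by blast
    then have "\<nu> {y} \<odot> t \<le> \<nu> {y} \<odot> f y"
      using t possibility_point_range[OF X \<nu>] fx by (intro tnorm_mono) auto
    then show ?thesis using y upper[of y] by simp
  qed
  have ge: "sup_integral X \<nu> f \<le> \<nu> {y \<in> topspace X. f x \<le> f y} \<odot> f x"
    unfolding x(2) using x(1) fx[of x] \<nu>_range possibility_point_range[OF X \<nu> x(1)]
      possibility_point_le[OF X \<nu> closed]
    by (intro tnorm_mono) auto
  have "\<exists>t\<in>S. sup_integral X \<nu> f \<le> \<nu> {x \<in> topspace X. t \<le> f x} \<odot> t"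
  \<comment> \<open>for \<open>f x = 0\<close> the integral is \<open>0\<close> and any layer will do, in case \<open>0 \<notin> S\<close>\<close>
  proof (cases "f x = 0")
    case True
    then have "sup_integral X \<nu> f = 0" using x possibility_point_range[OF X \<nu>] tnorm_zero_right by simp
    then show ?thesis
      using S tnorm_closed[OF \<nu>_range[of 1], of 1] by (intro bexI[of _ 1]) auto
  next
    case False
    then show ?thesis using ge fx[OF x(1)] S by (intro bexI[of _ "f x"]) auto
  qed
  then show ?thesis
    using le S(2)
    by (intro maximum_eqI) (blast intro: order_antisym, blast)
qed

lemma tintegral_eq_sup_integral:
  assumes "compactum X" "\<nu> \<in> possibilities X" "\<phi> \<in> CI X"
  shows "tintegral (\<odot>) X \<nu> \<phi> = sup_integral X \<nu> \<phi>"
proof -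
  have "{x \<in> topspace X. \<phi> x \<in> {t..1}} = {x \<in> topspace X. t \<le> \<phi> x}" for t
    using CI_range[OF assms(3)] by auto
  then have "tintegral (\<odot>) X \<nu> \<phi> = maximum ((\<lambda>t. \<nu> {x \<in> topspace X. t \<le> \<phi> x} \<odot> t) ` {0..1})"
    unfolding tintegral_def by simp
  also have "\<dots> = sup_integral X \<nu> \<phi>"
    by (rule sup_integral_layers[OF assms(1,2) CI_unit_usc[OF assms(3)]]) auto
  finally show ?thesis .
qed

lemma l_map_eq_sup_integral:
  "compactum X \<Longrightarrow> \<nu> \<in> possibilities X \<Longrightarrow> \<phi> \<in> CI X \<Longrightarrow> l_map (\<odot>) X \<nu> \<phi> = sup_integral X \<nu> \<phi>"
  by (simp add: l_map_def tintegral_eq_sup_integral)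

lemma sup_integral_mono:
  assumes X: "compactum X" and \<nu>: "\<nu> \<in> possibilities X" and f: "unit_usc X f" and g: "unit_usc X g"
    and le: "\<And>x. x \<in> topspace X \<Longrightarrow> f x \<le> g x"
  shows "sup_integral X \<nu> f \<le> sup_integral X \<nu> g"
proof -
  obtain x where x: "x \<in> topspace X" "sup_integral X \<nu> f = \<nu> {x} \<odot> f x"
    using sup_integral_attained[OF X \<nu> f] by blast
  have "\<nu> {x} \<odot> f x \<le> \<nu> {x} \<odot> g x"
    using le x f g possibility_point_range[OF X \<nu>] unfolding unit_usc_def
    by (intro tnorm_mono) auto
  then show ?thesis using sup_integral_upper[OF X \<nu> g x(1)] x(2) by simp
qed

lemma A_setI:
  assumes "\<mu> \<in> CI X \<rightarrow>\<^sub>E {0..1}" "\<mu> (\<lambda>x\<in>topspace X. 1) = 1"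
    "\<And>\<psi> \<phi>. \<psi> \<in> CI X \<Longrightarrow> \<phi> \<in> CI X \<Longrightarrow> \<mu> (\<lambda>x\<in>topspace X. max (\<psi> x) (\<phi> x)) = max (\<mu> \<psi>) (\<mu> \<phi>)"
    "\<And>c \<phi>. c \<in> {0..1} \<Longrightarrow> \<phi> \<in> CI X \<Longrightarrow> \<mu> (\<lambda>x\<in>topspace X. c \<odot> \<phi> x) = c \<odot> \<mu> \<phi>"
  shows "\<mu> \<in> A_set (\<odot>) X"
  using assms unfolding A_set_def by blast

lemma l_map_in_A_set:
  assumes X: "compactum X" and \<nu>: "\<nu> \<in> possibilities X"
  shows "l_map (\<odot>) X \<nu> \<in> A_set (\<odot>) X"
proof (rule A_setI)
  note l = l_map_eq_sup_integral[OF X \<nu>] and range = sup_integral_range[OF X \<nu> CI_unit_usc]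
    and upper = sup_integral_upper[OF X \<nu> CI_unit_usc]
    and mono = sup_integral_mono[OF X \<nu> CI_unit_usc CI_unit_usc]
    and \<nu>x = possibility_point_range[OF X \<nu>]
  show "l_map (\<odot>) X \<nu> \<in> CI X \<rightarrow>\<^sub>E {0..1}"
    using range by (auto simp: l) (auto simp: l_map_def)
  obtain x where "x \<in> topspace X" "\<nu> {x} = 1" using possibility_point_one[OF X \<nu>] by blast
  moreover have one: "(\<lambda>x\<in>topspace X. 1) \<in> CI X" by (rule CI_const) auto
  ultimately show "l_map (\<odot>) X \<nu> (\<lambda>x\<in>topspace X. 1) = 1"
    using range[OF one] upper[OF one] tnorm_one_right[of 1] by (force simp: l)
next
  note l = l_map_eq_sup_integral[OF X \<nu>] and upper = sup_integral_upper[OF X \<nu> CI_unit_usc]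
    and mono = sup_integral_mono[OF X \<nu> CI_unit_usc CI_unit_usc]
  fix \<psi> \<phi> assume \<psi>: "\<psi> \<in> CI X" and \<phi>: "\<phi> \<in> CI X"
  note m = CI_max[OF \<psi> \<phi>]
  obtain x where x0: "x \<in> topspace X"
    "sup_integral X \<nu> (\<lambda>x\<in>topspace X. max (\<psi> x) (\<phi> x)) = \<nu> {x} \<odot> (\<lambda>x\<in>topspace X. max (\<psi> x) (\<phi> x)) x"
    using sup_integral_attained[OF X \<nu> CI_unit_usc[OF m]] by blast
  then have x: "x \<in> topspace X"
    "sup_integral X \<nu> (\<lambda>x\<in>topspace X. max (\<psi> x) (\<phi> x)) = \<nu> {x} \<odot> max (\<psi> x) (\<phi> x)"
    by simp_all
  have "sup_integral X \<nu> (\<lambda>x\<in>topspace X. max (\<psi> x) (\<phi> x)) \<le> max (sup_integral X \<nu> \<psi>) (sup_integral X \<nu> \<phi>)"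
    using x upper[OF \<psi> x(1)] upper[OF \<phi> x(1)] by (auto simp: max_def)
  moreover have "sup_integral X \<nu> \<psi> \<le> sup_integral X \<nu> (\<lambda>x\<in>topspace X. max (\<psi> x) (\<phi> x))"
    "sup_integral X \<nu> \<phi> \<le> sup_integral X \<nu> (\<lambda>x\<in>topspace X. max (\<psi> x) (\<phi> x))"
    using mono[OF \<psi> m] mono[OF \<phi> m] by auto
  ultimately show "l_map (\<odot>) X \<nu> (\<lambda>x\<in>topspace X. max (\<psi> x) (\<phi> x)) = max (l_map (\<odot>) X \<nu> \<psi>) (l_map (\<odot>) X \<nu> \<phi>)"
    using l[OF \<psi>] l[OF \<phi>] l[OF m] by linarith
next
  note l = l_map_eq_sup_integral[OF X \<nu>] and upper = sup_integral_upper[OF X \<nu> CI_unit_usc]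
    and \<nu>x = possibility_point_range[OF X \<nu>]
  fix c \<phi> assume c: "c \<in> {0..1::real}" and \<phi>: "\<phi> \<in> CI X"
  note m = CI_tnorm[OF c \<phi>]
  have swap: "\<nu> {y} \<odot> (c \<odot> \<phi> y) = c \<odot> (\<nu> {y} \<odot> \<phi> y)" if "y \<in> topspace X" for y
    using tnorm_assoc[OF \<nu>x[OF that] c CI_range[OF \<phi> that]]
      tnorm_assoc[OF c \<nu>x[OF that] CI_range[OF \<phi> that]] tnorm_commute[OF c \<nu>x[OF that]] by simp
  obtain x where x0: "x \<in> topspace X"
    "sup_integral X \<nu> (\<lambda>x\<in>topspace X. c \<odot> \<phi> x) = \<nu> {x} \<odot> (\<lambda>x\<in>topspace X. c \<odot> \<phi> x) x"
    using sup_integral_attained[OF X \<nu> CI_unit_usc[OF m]] by blast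
  then have x: "x \<in> topspace X"
    "sup_integral X \<nu> (\<lambda>x\<in>topspace X. c \<odot> \<phi> x) = \<nu> {x} \<odot> (c \<odot> \<phi> x)"
    by simp_all
  obtain y where y: "y \<in> topspace X" "sup_integral X \<nu> \<phi> = \<nu> {y} \<odot> \<phi> y"
    using sup_integral_attained[OF X \<nu> CI_unit_usc[OF \<phi>]] by blast
  have "c \<odot> sup_integral X \<nu> \<phi> \<le> sup_integral X \<nu> (\<lambda>x\<in>topspace X. c \<odot> \<phi> x)"
    using upper[OF m y(1)] swap[OF y(1)] y by simp
  moreover have "\<nu> {x} \<odot> (c \<odot> \<phi> x) \<le> c \<odot> sup_integral X \<nu> \<phi>"
    unfolding swap[OF x(1)] using c tnorm_closed[OF \<nu>x[OF x(1)] CI_range[OF \<phi> x(1)]]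
      sup_integral_range[OF X \<nu> CI_unit_usc[OF \<phi>]] upper[OF \<phi> x(1)]
    by (intro tnorm_mono) auto
  ultimately show "l_map (\<odot>) X \<nu> (\<lambda>x\<in>topspace X. c \<odot> \<phi> x) = c \<odot> l_map (\<odot>) X \<nu> \<phi>"
    using l[OF \<phi>] l[OF m] x(2) by simp
qed

text \<open>For the direction from left to right take a Urysohn function that vanishes outside the open set
  \<open>{x. \<nu> {x} < a}\<close>.  The hypothesis \<open>0 < a\<close> takes care of the points where the function vanishes and
  of \<open>F = {}\<close>.\<close>

lemma possibility_less_iff_integral:
  assumes X: "compactum X" and \<nu>: "\<nu> \<in> possibilities X" and F: "closedin X F" and a: "0 < a"
  shows "\<nu> F < a \<longleftrightarrow> (\<exists>\<phi>\<in>CI X. (\<forall>x\<in>F. \<phi> x = 1) \<and> l_map (\<odot>) X \<nu> \<phi> < a)"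
proof
  assume less: "\<nu> F < a"
  have FX: "F \<subseteq> topspace X" using F closedin_subset by blast
  define U where "U = {x \<in> topspace X. \<nu> {x} < a}"
  have "openin X U"
    using possibility_point_unit_usc[OF X \<nu>]
    by (simp add: U_def unit_usc_def upper_semicontinuous_def)
  moreover have "F \<subseteq> U"
    using possibility_point_le[OF X \<nu> F] less FX by (fastforce simp: U_def)
  ultimately obtain \<phi> where \<phi>: "\<phi> \<in> CI X" "\<And>x. x \<in> F \<Longrightarrow> \<phi> x = 1"
    "\<And>x. x \<in> topspace X \<Longrightarrow> x \<notin> U \<Longrightarrow> \<phi> x = 0"
    using CI_Urysohn[OF X F] by blast
  obtain x where x: "x \<in> topspace X" "sup_integral X \<nu> \<phi> = \<nu> {x} \<odot> \<phi> x"
    using sup_integral_attained[OF X \<nu> CI_unit_usc[OF \<phi>(1)]] by blast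
  note \<nu>x = possibility_point_range[OF X \<nu> x(1)]
  have "\<nu> {x} \<odot> \<phi> x \<le> \<nu> {x} \<odot> 1"
    using \<nu>x CI_range[OF \<phi>(1) x(1)] by (intro tnorm_mono) auto
  then have "\<nu> {x} \<odot> \<phi> x < a"
    using \<phi>(3)[OF x(1)] tnorm_zero_right[OF \<nu>x] tnorm_one_right[OF \<nu>x] a x(1)
    by (cases "\<nu> {x} < a") (auto simp: U_def)
  then show "\<exists>\<phi>\<in>CI X. (\<forall>x\<in>F. \<phi> x = 1) \<and> l_map (\<odot>) X \<nu> \<phi> < a"
    using \<phi> x l_map_eq_sup_integral[OF X \<nu> \<phi>(1)] by (intro bexI[of _ \<phi>]) auto
next
  assume "\<exists>\<phi>\<in>CI X. (\<forall>x\<in>F. \<phi> x = 1) \<and> l_map (\<odot>) X \<nu> \<phi> < a"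
  then obtain \<phi> where \<phi>: "\<phi> \<in> CI X" "\<forall>x\<in>F. \<phi> x = 1" "sup_integral X \<nu> \<phi> < a"
    using l_map_eq_sup_integral[OF X \<nu>] by auto
  show "\<nu> F < a"
  proof (cases "F = {}")
    case False
    then obtain x where x: "x \<in> F" "\<nu> F = \<nu> {x}" using possibility_attained[OF X \<nu> F] by blast
    then have xX: "x \<in> topspace X" using F closedin_subset by blast
    have "\<nu> {x} \<odot> \<phi> x \<le> sup_integral X \<nu> \<phi>"
      by (rule sup_integral_upper[OF X \<nu> CI_unit_usc[OF \<phi>(1)] xX])
    then show ?thesis
      using x \<phi> tnorm_one_right[OF possibility_point_range[OF X \<nu> xX]] by simp
  qed (simp add: a possibility_empty[OF \<nu>])
qed

text \<open>A Urysohn function for \<open>K \<subseteq> U\<close> has an integral of at least \<open>\<nu> K\<close>; conversely, if the function vanishes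
  outside \<open>U\<close> and the integral exceeds \<open>a \<ge> 0\<close>, it is attained at a point of \<open>U\<close>.\<close>

lemma open_value_greater_iff_integral:
  assumes X: "compactum X" and \<nu>: "\<nu> \<in> possibilities X" and U: "openin X U" and a: "0 \<le> a"
  shows "a < open_value X \<nu> U \<longleftrightarrow>
    (\<exists>\<phi>\<in>CI X. (\<forall>x\<in>topspace X - U. \<phi> x = 0) \<and> a < l_map (\<odot>) X \<nu> \<phi>)"
proof
  assume "a < open_value X \<nu> U"
  then obtain K where K: "closedin X K" "K \<subseteq> U" "a < \<nu> K"
    unfolding open_value_greater_iff[OF \<nu>] by blast
  obtain \<phi> where \<phi>: "\<phi> \<in> CI X" "\<And>x. x \<in> K \<Longrightarrow> \<phi> x = 1"
    "\<And>x. x \<in> topspace X \<Longrightarrow> x \<notin> U \<Longrightarrow> \<phi> x = 0"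
    using CI_Urysohn[OF X K(1) U K(2)] by blast
  have "K \<noteq> {}" using K(3) a possibility_empty[OF \<nu>] by auto
  then obtain x where x: "x \<in> K" "\<nu> K = \<nu> {x}" using possibility_attained[OF X \<nu> K(1)] by blast
  then have xX: "x \<in> topspace X" using K closedin_subset by blast
  have "\<nu> {x} \<odot> \<phi> x \<le> sup_integral X \<nu> \<phi>"
    by (rule sup_integral_upper[OF X \<nu> CI_unit_usc[OF \<phi>(1)] xX])
  then have "a < sup_integral X \<nu> \<phi>"
    using x \<phi>(2) K(3) tnorm_one_right[OF possibility_point_range[OF X \<nu> xX]] by simp
  then show "\<exists>\<phi>\<in>CI X. (\<forall>x\<in>topspace X - U. \<phi> x = 0) \<and> a < l_map (\<odot>) X \<nu> \<phi>"
    using \<phi> l_map_eq_sup_integral[OF X \<nu> \<phi>(1)] by (intro bexI[of _ \<phi>]) auto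
next
  assume "\<exists>\<phi>\<in>CI X. (\<forall>x\<in>topspace X - U. \<phi> x = 0) \<and> a < l_map (\<odot>) X \<nu> \<phi>"
  then obtain \<phi> where \<phi>: "\<phi> \<in> CI X" "\<forall>x\<in>topspace X - U. \<phi> x = 0" "a < sup_integral X \<nu> \<phi>"
    using l_map_eq_sup_integral[OF X \<nu>] by auto
  obtain x where x: "x \<in> topspace X" "sup_integral X \<nu> \<phi> = \<nu> {x} \<odot> \<phi> x"
    using sup_integral_attained[OF X \<nu> CI_unit_usc[OF \<phi>(1)]] by blast
  note \<nu>x = possibility_point_range[OF X \<nu> x(1)]
  have "x \<in> U"
    using \<phi> x a tnorm_zero_right[OF \<nu>x] by force
  moreover have "\<nu> {x} \<odot> \<phi> x \<le> \<nu> {x} \<odot> 1"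
    using \<nu>x CI_range[OF \<phi>(1) x(1)] by (intro tnorm_mono) auto
  then have "a < \<nu> {x}" using tnorm_one_right[OF \<nu>x] \<phi>(3) x(2) by simp
  ultimately show "a < open_value X \<nu> U"
    unfolding open_value_greater_iff[OF \<nu>] using compactum_closed_singleton[OF X x(1)] by blast
qed

text \<open>By \<open>possibility_less_iff_integral\<close> the integral determines the values of a capacity at points.\<close>

lemma l_map_inj:
  assumes X: "compactum X"
  shows "inj_on (l_map (\<odot>) X) (possibilities X)"
proof (rule inj_onI)
  fix \<nu> \<nu>' assume \<nu>: "\<nu> \<in> possibilities X" and \<nu>': "\<nu>' \<in> possibilities X"
    and eq: "l_map (\<odot>) X \<nu> = l_map (\<odot>) X \<nu>'"
  show "\<nu> = \<nu>'"
  proof (rule possibility_eqI[OF X \<nu> \<nu>'])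
    fix x assume x: "x \<in> topspace X"
    have "\<nu> {x} < a \<longleftrightarrow> \<nu>' {x} < a" if "0 < a" for a
      using possibility_less_iff_integral[OF X \<nu> compactum_closed_singleton[OF X x] that]
        possibility_less_iff_integral[OF X \<nu>' compactum_closed_singleton[OF X x] that] eq by simp
    from this[of "\<nu> {x}"] this[of "\<nu>' {x}"] show "\<nu> {x} = \<nu>' {x}"
      using possibility_point_range[OF X \<nu> x] possibility_point_range[OF X \<nu>' x] by force
  qed
qed

end

section \<open>The topology of the space of functionals\<close>

context cont_tnorm
begin

lemma
  assumes "\<mu> \<in> A_set (\<odot>) X"
  shows A_set_one: "\<mu> (\<lambda>x\<in>topspace X. 1) = 1"
    and A_set_max: "\<psi> \<in> CI X \<Longrightarrow> \<phi> \<in> CI X \<Longrightarrow>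
      \<mu> (\<lambda>x\<in>topspace X. max (\<psi> x) (\<phi> x)) = max (\<mu> \<psi>) (\<mu> \<phi>)"
    and A_set_tnorm: "c \<in> {0..1} \<Longrightarrow> \<phi> \<in> CI X \<Longrightarrow>
      \<mu> (\<lambda>x\<in>topspace X. c \<odot> \<phi> x) = c \<odot> \<mu> \<phi>"
    and A_set_range: "\<phi> \<in> CI X \<Longrightarrow> \<mu> \<phi> \<in> {0..1}"
    and A_set_extensional: "\<mu> \<in> extensional (CI X)"
  using assms unfolding A_set_def PiE_def by blast+

lemma topspace_A_space: "topspace (A_space (\<odot>) X) = A_set (\<odot>) X"
  unfolding A_space_def topspace_subtopology topspace_product_topology A_set_def by auto

lemma A_space_eval_CI:
  assumes "\<phi> \<in> CI X"
  shows "(\<lambda>\<mu>\<in>topspace (A_space (\<odot>) X). \<mu> \<phi>) \<in> CI (A_space (\<odot>) X)"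
proof (rule CI_restrict)
  show "continuous_map (A_space (\<odot>) X) euclideanreal (\<lambda>\<mu>. \<mu> \<phi>)"
    unfolding A_space_def
    using continuous_map_into_fulltopology[of _ euclideanreal "{0..1}"]
      continuous_map_product_projection[OF assms, of "\<lambda>_. top_of_set {0..1::real}"]
    by (intro continuous_map_from_subtopology) blast
  show "\<mu> \<phi> \<in> {0..1}" if "\<mu> \<in> topspace (A_space (\<odot>) X)" for \<mu>
    using that A_set_range assms unfolding topspace_A_space by blast
qed

text \<open>Each equation in the definition of \<open>A\<^sup>* X\<close> involves finitely many coordinates and is a closed
  condition, the last one because the t-norm is continuous.\<close>

lemma A_space_compactum: "compactum (A_space (\<odot>) X)"
proof -
  let ?P = "product_topology (\<lambda>_. top_of_set {0..1::real}) (CI X)"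
  have proj: "continuous_map ?P (top_of_set {0..1}) (\<lambda>\<mu>. \<mu> \<phi>)" if "\<phi> \<in> CI X" for \<phi>
    by (rule continuous_map_product_projection[OF that])
  have projr: "continuous_map ?P euclideanreal (\<lambda>\<mu>. \<mu> \<phi>)" if "\<phi> \<in> CI X" for \<phi>
    by (rule continuous_map_into_fulltopology[OF proj[OF that]])
  have projT: "continuous_map ?P euclideanreal (\<lambda>\<mu>. c \<odot> \<mu> \<phi>)" if "\<phi> \<in> CI X" "c \<in> {0..1}" for c \<phi>
    using continuous_map_compose[OF proj[OF that(1)] tnorm_left_continuous_map[OF that(2)]]
    by (simp add: o_def)
  have top: "topspace ?P = CI X \<rightarrow>\<^sub>E {0..1}" by simp
  let ?One = "{\<mu> \<in> topspace ?P. \<mu> (\<lambda>x\<in>topspace X. 1) = 1}"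
  let ?Max = "\<lambda>\<psi> \<phi>. {\<mu> \<in> topspace ?P. \<mu> (\<lambda>x\<in>topspace X. max (\<psi> x) (\<phi> x)) = max (\<mu> \<psi>) (\<mu> \<phi>)}"
  let ?T = "\<lambda>c \<phi>. {\<mu> \<in> topspace ?P. \<mu> (\<lambda>x\<in>topspace X. c \<odot> \<phi> x) = c \<odot> \<mu> \<phi>}"
  have "closedin ?P ?One"
    by (rule closedin_continuous_maps_eq[OF Hausdorff_space_euclidean projr[OF CI_const]]) auto
  moreover have "closedin ?P (\<Inter>\<psi>\<in>CI X. \<Inter>\<phi>\<in>CI X. ?Max \<psi> \<phi>)"
    by (intro closedin_INT CI_nonempty closedin_continuous_maps_eq[OF Hausdorff_space_euclidean]
        projr CI_max continuous_map_real_max)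
  moreover have "closedin ?P (\<Inter>c\<in>{0..1}. \<Inter>\<phi>\<in>CI X. ?T c \<phi>)"
    by (intro closedin_INT CI_nonempty closedin_continuous_maps_eq[OF Hausdorff_space_euclidean]
        projr CI_tnorm projT) auto
  ultimately have "closedin ?P (?One \<inter> (\<Inter>\<psi>\<in>CI X. \<Inter>\<phi>\<in>CI X. ?Max \<psi> \<phi>) \<inter> (\<Inter>c\<in>{0..1}. \<Inter>\<phi>\<in>CI X. ?T c \<phi>))"
    by (intro closedin_Int)
  moreover have "?One \<inter> (\<Inter>\<psi>\<in>CI X. \<Inter>\<phi>\<in>CI X. ?Max \<psi> \<phi>) \<inter> (\<Inter>c\<in>{0..1}. \<Inter>\<phi>\<in>CI X. ?T c \<phi>) = A_set (\<odot>) X"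
    unfolding A_set_def top by blast
  ultimately have "closedin ?P (A_set (\<odot>) X)" by simp
  moreover have "compact_space ?P"
    by (simp add: compact_space_product_topology compact_space_subtopology)
  ultimately have "compact_space (A_space (\<odot>) X)"
    unfolding A_space_def by (intro compact_space_subtopology closedin_compact_space)
  moreover have "Hausdorff_space ?P"
    by (simp add: Hausdorff_space_product_topology Hausdorff_space_subtopology)
  ultimately show ?thesis
    by (simp add: compactum_def A_space_def Hausdorff_space_subtopology)
qed

section \<open>Continuity of the integral\<close>

text \<open>Upper semicontinuity in the capacity comes from the joint upper semicontinuity of
  \<open>(x, \<nu>) \<mapsto> \<nu> {x} \<odot> \<phi> x\<close> by maximising over the compactum \<open>X\<close>.  For lower semicontinuity, suppose the
  integral is attained at \<open>x\<close>: capacities whose value on the open set \<open>{\<phi> > \<phi> x - e}\<close> is not much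
  smaller than \<open>\<nu> {x}\<close> have an integral that is not much smaller.\<close>

lemma Pi_space_integral_continuous:
  assumes X: "compactum X" and \<phi>: "\<phi> \<in> CI X"
  shows "continuous_map (Pi_space X) (top_of_set {0..1}) (\<lambda>\<nu>. l_map (\<odot>) X \<nu> \<phi>)"
  unfolding continuous_map_upper_lower_semicontinuous_lt_gen topspace_Pi_space
proof (intro conjI ballI allI)
  show range: "l_map (\<odot>) X \<nu> \<phi> \<in> {0..1}" if "\<nu> \<in> possibilities X" for \<nu>
    using A_set_range[OF l_map_in_A_set[OF X that] \<phi>] .
  fix a
  show "openin (Pi_space X) {\<nu> \<in> possibilities X. a < l_map (\<odot>) X \<nu> \<phi>}"
  proof (subst openin_subopen, intro ballI)
    fix \<nu> assume "\<nu> \<in> {\<nu> \<in> possibilities X. a < l_map (\<odot>) X \<nu> \<phi>}"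
    then have \<nu>: "\<nu> \<in> possibilities X" and a: "a < l_map (\<odot>) X \<nu> \<phi>" by auto
    show "\<exists>N. openin (Pi_space X) N \<and> \<nu> \<in> N \<and> N \<subseteq> {\<nu> \<in> possibilities X. a < l_map (\<odot>) X \<nu> \<phi>}"
    proof (cases "a < 0")
      case True
      have "topspace (Pi_space X) \<subseteq> {\<nu> \<in> possibilities X. a < l_map (\<odot>) X \<nu> \<phi>}"
        unfolding topspace_Pi_space using range True by fastforce
      then show ?thesis using \<nu> topspace_Pi_space openin_topspace by blast
    next
      case False
      obtain x where x: "x \<in> topspace X" "sup_integral X \<nu> \<phi> = \<nu> {x} \<odot> \<phi> x"
        using sup_integral_attained[OF X \<nu> CI_unit_usc[OF \<phi>]] by blast
      note \<nu>x = possibility_point_range[OF X \<nu> x(1)] and \<phi>x = CI_range[OF \<phi> x(1)]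
      have less: "a < \<nu> {x} \<odot> \<phi> x"
        using a x by (simp add: l_map_eq_sup_integral[OF X \<nu> \<phi>])
      obtain e where e: "0 < e" "\<And>p' q'. p' \<in> {0..1} \<Longrightarrow> q' \<in> {0..1} \<Longrightarrow>
          \<nu> {x} - e < p' \<Longrightarrow> \<phi> x - e < q' \<Longrightarrow> a < p' \<odot> q'"
        using tnorm_greater_nearby[OF \<nu>x \<phi>x less] by blast
      \<comment> \<open>needed to find \<open>s \<ge> 0\<close> strictly below \<open>\<nu> {x}\<close>\<close>
      have "\<nu> {x} \<noteq> 0" using less False tnorm_zero_left[OF \<phi>x] by auto
      define s where "s = max 0 (\<nu> {x} - e / 2)"
      have s: "s \<in> {0..1}" "s < \<nu> {x}" "\<nu> {x} - e < s"
        using e(1) \<nu>x \<open>\<nu> {x} \<noteq> 0\<close> by (auto simp: s_def)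
      define U where "U = {y \<in> topspace X. \<phi> x - e < \<phi> y}"
      have U: "openin X U" unfolding U_def by (rule CI_open_greater[OF \<phi>])
      let ?N = "{c \<in> possibilities X. s < open_value X c U}"
      have "openin (Pi_space X) ?N" by (rule Pi_space_open_value_open[OF U s(1)])
      moreover have "\<nu> \<in> ?N"
        using \<nu> s(2) x(1) e(1) compactum_closed_singleton[OF X x(1)]
        by (auto simp: open_value_greater_iff[OF \<nu>] U_def intro!: exI[of _ "{x}"])
      moreover have "a < l_map (\<odot>) X c \<phi>" if "c \<in> ?N" for c
      proof -
        have c: "c \<in> possibilities X" using that by simp
        have "s < open_value X c U" using that by simp
        then obtain K where K: "closedin X K" "K \<subseteq> U" "s < c K"
          unfolding open_value_greater_iff[OF c] by blast
        then have "K \<noteq> {}" using s(1) possibility_empty[OF c] by auto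
        then obtain y where y: "y \<in> K" "c K = c {y}" using possibility_attained[OF X c K(1)] by blast
        then have yX: "y \<in> topspace X" "\<phi> x - e < \<phi> y" using K(2) by (auto simp: U_def)
        have "a < c {y} \<odot> \<phi> y"
          using K(3) y(2) s(3) yX
          by (intro e(2) possibility_point_range[OF X c] CI_range[OF \<phi>]) auto
        also have "\<dots> \<le> l_map (\<odot>) X c \<phi>"
          using sup_integral_upper[OF X c CI_unit_usc[OF \<phi>] yX(1)]
          by (simp add: l_map_eq_sup_integral[OF X c \<phi>])
        finally show ?thesis .
      qed
      ultimately show ?thesis by (intro exI[of _ ?N]) auto
    qed
  qed
next
  fix a
  let ?f = "\<lambda>z. (\<lambda>(x, c). c {x}) z \<odot> (\<phi> \<circ> fst) z"
  have "upper_semicontinuous (prod_topology X (Pi_space X)) ?f"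
  proof (rule upper_semicontinuous_tnorm)
    show "upper_semicontinuous (prod_topology X (Pi_space X)) (\<lambda>(x, c). c {x})"
      by (rule density_jointly_upper_semicontinuous[OF X])
    show "upper_semicontinuous (prod_topology X (Pi_space X)) (\<phi> \<circ> fst)"
      by (rule upper_semicontinuous_compose[OF CI_upper_semicontinuous[OF \<phi>] continuous_map_fst])
  qed (auto simp: topspace_Pi_space possibility_point_range[OF X, simplified] CI_range[OF \<phi>, simplified])
  then have "upper_semicontinuous (Pi_space X) (\<lambda>\<nu>. l_map (\<odot>) X \<nu> \<phi>)"
  proof (rule upper_semicontinuous_marginal[rotated])
    show "compact_space X" using X by (simp add: compactum_def)
    fix \<nu> assume "\<nu> \<in> topspace (Pi_space X)"
    then have \<nu>: "\<nu> \<in> possibilities X" by (simp add: topspace_Pi_space)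
    note l = l_map_eq_sup_integral[OF X \<nu> \<phi>]
    show "\<exists>x\<in>topspace X. l_map (\<odot>) X \<nu> \<phi> = ?f (x, \<nu>)"
      using sup_integral_attained[OF X \<nu> CI_unit_usc[OF \<phi>]] by (auto simp: l)
    show "?f (x, \<nu>) \<le> l_map (\<odot>) X \<nu> \<phi>" if "x \<in> topspace X" for x
      using sup_integral_upper[OF X \<nu> CI_unit_usc[OF \<phi>] that] by (simp add: l)
  qed
  then show "openin (Pi_space X) {\<nu> \<in> possibilities X. l_map (\<odot>) X \<nu> \<phi> < a}"
    by (simp add: upper_semicontinuous_def topspace_Pi_space)
qed

lemma l_map_continuous:
  assumes X: "compactum X"
  shows "continuous_map (Pi_space X) (A_space (\<odot>) X) (l_map (\<odot>) X)"
proof -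
  have "continuous_map (Pi_space X) (product_topology (\<lambda>_. top_of_set {0..1}) (CI X)) (l_map (\<odot>) X)"
    unfolding continuous_map_componentwise
    using Pi_space_integral_continuous[OF X] by (auto simp: l_map_def)
  then show ?thesis
    unfolding A_space_def using l_map_in_A_set[OF X]
    by (intro continuous_map_into_subtopology) (auto simp: topspace_Pi_space)
qed

section \<open>Every functional is an integral\<close>

lemma A_set_zero:
  assumes "\<mu> \<in> A_set (\<odot>) X"
  shows "\<mu> (\<lambda>x\<in>topspace X. 0) = 0"
proof -
  have "(\<lambda>x\<in>topspace X. 0 \<odot> (\<lambda>x\<in>topspace X. 1) x) = (\<lambda>x\<in>topspace X. 0)"
    using tnorm_zero_left[of 1] by (intro restrict_ext) simp
  then show ?thesis
    using A_set_tnorm[OF assms, of 0 "\<lambda>x\<in>topspace X. 1"] CI_const[of 1 X] A_set_one[OF assms]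
      tnorm_zero_left[of 1] by simp
qed

lemma A_set_mono:
  assumes \<mu>: "\<mu> \<in> A_set (\<odot>) X" and \<psi>: "\<psi> \<in> CI X" and \<phi>: "\<phi> \<in> CI X"
    and le: "\<And>x. x \<in> topspace X \<Longrightarrow> \<psi> x \<le> \<phi> x"
  shows "\<mu> \<psi> \<le> \<mu> \<phi>"
proof -
  have "(\<lambda>x\<in>topspace X. max (\<psi> x) (\<phi> x)) = \<phi>"
    using le by (intro CI_ext[OF CI_max[OF \<psi> \<phi>] \<phi>]) (simp add: max_def)
  then show ?thesis using A_set_max[OF \<mu> \<psi> \<phi>] by simp
qed

text \<open>The functional preserves finite maxima.  The hypothesis \<open>0 < a\<close> provides the constant \<open>0\<close> as upper
  bound of the empty family.\<close>

lemma A_set_finite_upper_bound: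
  assumes \<mu>: "\<mu> \<in> A_set (\<odot>) X" and a: "0 < a" and "finite I" "I \<subseteq> CI X" "\<And>g. g \<in> I \<Longrightarrow> \<mu> g < a"
  shows "\<exists>h\<in>CI X. \<mu> h < a \<and> (\<forall>g\<in>I. \<forall>x\<in>topspace X. g x \<le> h x)"
  using assms(3-5)
proof (induction rule: finite_induct)
  case empty
  have "\<mu> (\<lambda>x\<in>topspace X. 0) < a" using A_set_zero[OF \<mu>] a by simp
  moreover have "(\<lambda>x\<in>topspace X. 0) \<in> CI X" by (rule CI_const) simp
  ultimately show ?case by blast
next
  case (insert g I)
  then obtain h where h: "h \<in> CI X" "\<mu> h < a" "\<forall>g\<in>I. \<forall>x\<in>topspace X. g x \<le> h x" by auto
  have g: "g \<in> CI X" "\<mu> g < a" using insert.prems by auto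
  define k where "k = (\<lambda>x\<in>topspace X. max (g x) (h x))"
  have "k \<in> CI X" unfolding k_def by (rule CI_max[OF g(1) h(1)])
  moreover have "\<mu> k < a" unfolding k_def A_set_max[OF \<mu> g(1) h(1)] using g(2) h(2) by simp
  moreover have "\<forall>f\<in>insert g I. \<forall>x\<in>topspace X. f x \<le> k x"
    using h(3) by (auto simp: k_def le_max_iff_disj)
  ultimately show ?case by blast
qed

text \<open>Requiring \<open>\<psi> = 1\<close> on a neighbourhood of \<open>x\<close>, not only at \<open>x\<close>, makes upper semicontinuity
  immediate.\<close>

definition functional_density :: "'a topology \<Rightarrow> (('a \<Rightarrow> real) \<Rightarrow> real) \<Rightarrow> 'a \<Rightarrow> real" where
  "functional_density X \<mu> x =
     Inf {\<mu> \<psi> |\<psi>. \<psi> \<in> CI X \<and> (\<exists>U. openin X U \<and> x \<in> U \<and> (\<forall>y\<in>U. \<psi> y = 1))}"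

lemma functional_density_less_iff:
  assumes \<mu>: "\<mu> \<in> A_set (\<odot>) X" and x: "x \<in> topspace X"
  shows "functional_density X \<mu> x < a \<longleftrightarrow>
    (\<exists>\<psi>\<in>CI X. \<exists>U. openin X U \<and> x \<in> U \<and> (\<forall>y\<in>U. \<psi> y = 1) \<and> \<mu> \<psi> < a)"
proof -
  let ?S = "{\<mu> \<psi> |\<psi>. \<psi> \<in> CI X \<and> (\<exists>U. openin X U \<and> x \<in> U \<and> (\<forall>y\<in>U. \<psi> y = 1))}"
  have "\<mu> (\<lambda>x\<in>topspace X. 1) \<in> ?S"
    using CI_const[of 1 X] x openin_topspace[of X]
    by (intro CollectI exI[of _ "\<lambda>x\<in>topspace X. 1"] conjI refl exI[of _ "topspace X"]) auto
  moreover have "bdd_below ?S"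
    using A_set_range[OF \<mu>] by (intro bdd_belowI[of _ 0]) auto
  ultimately have "Inf ?S < a \<longleftrightarrow> (\<exists>s\<in>?S. s < a)"
    by (intro cInf_less_iff) auto
  then show ?thesis unfolding functional_density_def by blast
qed

lemma functional_density_range:
  assumes \<mu>: "\<mu> \<in> A_set (\<odot>) X" and x: "x \<in> topspace X"
  shows "functional_density X \<mu> x \<in> {0..1}"
proof -
  have "\<not> functional_density X \<mu> x < 0"
    unfolding functional_density_less_iff[OF assms] using A_set_range[OF \<mu>] by fastforce
  moreover have "functional_density X \<mu> x < 1 + e" if "0 < e" for e
    unfolding functional_density_less_iff[OF assms]
    using CI_const[of 1 X] x A_set_one[OF \<mu>] that openin_topspace[of X]
    by (intro bexI[of _ "\<lambda>x\<in>topspace X. 1"] exI[of _ "topspace X"]) auto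
  ultimately show ?thesis by (auto intro: field_le_epsilon less_imp_le)
qed

lemma functional_density_unit_usc:
  assumes \<mu>: "\<mu> \<in> A_set (\<odot>) X"
  shows "unit_usc X (functional_density X \<mu>)"
  unfolding unit_usc_def
proof (intro conjI ballI functional_density_range[OF \<mu>] upper_semicontinuousI_local)
  fix x a assume x: "x \<in> topspace X" "functional_density X \<mu> x < a"
  then obtain \<psi> U where U: "\<psi> \<in> CI X" "openin X U" "x \<in> U" "\<forall>y\<in>U. \<psi> y = 1" "\<mu> \<psi> < a"
    unfolding functional_density_less_iff[OF \<mu> x(1)] by blast
  have "functional_density X \<mu> y < a" if "y \<in> U" for y
  proof -
    have "y \<in> topspace X" using that openin_subset[OF U(2)] by blast
    then show ?thesis unfolding functional_density_less_iff[OF \<mu> \<open>y \<in> topspace X\<close>] using U that by blast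
  qed
  then show "\<exists>U. openin X U \<and> x \<in> U \<and> (\<forall>y\<in>U. functional_density X \<mu> y < a)" using U by blast
qed

text \<open>For \<open>t\<close> close to \<open>\<phi> x\<close> and not above it, there is a function \<open>\<psi>\<close> that is \<open>1\<close> near \<open>x\<close> and vanishes
  where \<open>\<phi> < t\<close>, so \<open>t \<odot> \<psi> \<le> \<phi>\<close> and hence \<open>t \<odot> d x \<le> t \<odot> \<mu> \<psi> \<le> \<mu> \<phi>\<close>, where \<open>d\<close> is the density.\<close>

lemma functional_density_tnorm_le:
  assumes X: "compactum X" and \<mu>: "\<mu> \<in> A_set (\<odot>) X" and \<phi>: "\<phi> \<in> CI X" and x: "x \<in> topspace X"
  shows "functional_density X \<mu> x \<odot> \<phi> x \<le> \<mu> \<phi>"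
proof (rule ccontr)
  let ?d = "functional_density X \<mu> x"
  assume "\<not> ?d \<odot> \<phi> x \<le> \<mu> \<phi>"
  then have less: "\<mu> \<phi> < ?d \<odot> \<phi> x" by simp
  note d = functional_density_range[OF \<mu> x] and \<phi>x = CI_range[OF \<phi> x]
  obtain e where e: "0 < e" "\<And>p' q'. p' \<in> {0..1} \<Longrightarrow> q' \<in> {0..1} \<Longrightarrow>
      ?d - e < p' \<Longrightarrow> \<phi> x - e < q' \<Longrightarrow> \<mu> \<phi> < p' \<odot> q'"
    using tnorm_greater_nearby[OF d \<phi>x less] by blast
  define t where "t = max 0 (\<phi> x - e / 2)"
  have t: "t \<in> {0..1}" "\<phi> x - e < t" using e(1) \<phi>x by (auto simp: t_def)
  define U where "U = {y \<in> topspace X. \<phi> x - e / 2 < \<phi> y}"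
  have U: "openin X U" unfolding U_def by (rule CI_open_greater[OF \<phi>])
  have xU: "{x} \<subseteq> U" using x e(1) by (simp add: U_def)
  obtain V where V: "openin X V" "{x} \<subseteq> V" "X closure_of V \<subseteq> U"
    using compactum_normal[OF X] U xU compactum_closed_singleton[OF X x]
    unfolding normal_space_alt by meson
  obtain \<psi> where \<psi>: "\<psi> \<in> CI X" "\<And>y. y \<in> X closure_of V \<Longrightarrow> \<psi> y = 1"
    "\<And>y. y \<in> topspace X \<Longrightarrow> y \<notin> U \<Longrightarrow> \<psi> y = 0"
    using CI_Urysohn[OF X closedin_closure_of U V(3)] by blast
  have \<psi>V: "\<forall>y\<in>V. \<psi> y = 1" using \<psi>(2) closure_of_subset[OF openin_subset[OF V(1)]] by blast
  have "\<not> ?d < ?d" by simp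
  then have d_le: "?d \<le> \<mu> \<psi>"
    using functional_density_less_iff[OF \<mu> x, of ?d] \<psi>(1) \<psi>V V by (meson insert_subset not_le)
  have "t \<odot> \<psi> y \<le> \<phi> y" if y: "y \<in> topspace X" for y
  proof (cases "y \<in> U")
    case True
    have "t \<odot> \<psi> y \<le> t \<odot> 1" using t CI_range[OF \<psi>(1) y] by (intro tnorm_mono) auto
    also have "\<dots> = t" by (rule tnorm_one_right[OF t(1)])
    also have "\<dots> \<le> \<phi> y" using True CI_range[OF \<phi> y] by (auto simp: t_def U_def)
    finally show ?thesis .
  next
    case False
    then show ?thesis using \<psi>(3)[OF y] tnorm_zero_right[OF t(1)] CI_range[OF \<phi> y] by simp
  qed
  then have "\<mu> (\<lambda>y\<in>topspace X. t \<odot> \<psi> y) \<le> \<mu> \<phi>"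
    by (intro A_set_mono[OF \<mu> CI_tnorm[OF t(1) \<psi>(1)] \<phi>]) simp
  then have "t \<odot> \<mu> \<psi> \<le> \<mu> \<phi>" by (simp add: A_set_tnorm[OF \<mu> t(1) \<psi>(1)])
  moreover have "?d \<odot> t \<le> t \<odot> \<mu> \<psi>"
    unfolding tnorm_commute[OF d t(1)] using t(1) d d_le A_set_range[OF \<mu> \<psi>(1)]
    by (intro tnorm_mono) auto
  moreover have "\<mu> \<phi> < ?d \<odot> t" by (rule e(2)[OF d t(1)]) (use e(1) t(2) in auto)
  ultimately show False by simp
qed

text \<open>Near each point \<open>x\<close> the function \<open>\<phi>\<close> is below \<open>s \<odot> \<psi>\<close>, where \<open>s\<close> is slightly above \<open>\<phi> x\<close> and \<open>\<psi>\<close>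
  is \<open>1\<close> near \<open>x\<close> with \<open>\<mu> \<psi>\<close> slightly above the density, so that \<open>\<mu> (s \<odot> \<psi>) = s \<odot> \<mu> \<psi> < a\<close>.  Finitely
  many of these functions dominate \<open>\<phi>\<close> everywhere.\<close>

lemma functional_less_if_density_less:
  assumes X: "compactum X" and \<mu>: "\<mu> \<in> A_set (\<odot>) X" and \<phi>: "\<phi> \<in> CI X" and a: "0 < a"
    and less: "\<And>x. x \<in> topspace X \<Longrightarrow> functional_density X \<mu> x \<odot> \<phi> x < a"
  shows "\<mu> \<phi> < a"
proof -
  have "\<exists>g U. g \<in> CI X \<and> \<mu> g < a \<and> openin X U \<and> x \<in> U \<and> (\<forall>y\<in>U. \<phi> y \<le> g y)"
    if x: "x \<in> topspace X" for x
  proof -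
    let ?d = "functional_density X \<mu> x"
    note d = functional_density_range[OF \<mu> x] and \<phi>x = CI_range[OF \<phi> x]
    obtain e where e: "0 < e" "\<And>p' q'. p' \<in> {0..1} \<Longrightarrow> q' \<in> {0..1} \<Longrightarrow>
        p' < ?d + e \<Longrightarrow> q' < \<phi> x + e \<Longrightarrow> p' \<odot> q' < a"
      using tnorm_less_nearby[OF d \<phi>x less[OF x]] by blast
    have "?d < ?d + e" using e(1) by simp
    then obtain \<psi> U where \<psi>: "\<psi> \<in> CI X" "openin X U" "x \<in> U" "\<forall>y\<in>U. \<psi> y = 1" "\<mu> \<psi> < ?d + e"
      unfolding functional_density_less_iff[OF \<mu> x] by blast
    define s where "s = min 1 (\<phi> x + e / 2)"
    have s: "s \<in> {0..1}" "s < \<phi> x + e" using e(1) \<phi>x by (auto simp: s_def)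
    let ?V = "{y \<in> topspace X. \<phi> y < \<phi> x + e / 2}"
    have V: "openin X ?V"
      by (rule upper_semicontinuous_openD[OF CI_upper_semicontinuous[OF \<phi>]])
    have "s \<odot> \<mu> \<psi> < a"
      unfolding tnorm_commute[OF s(1) A_set_range[OF \<mu> \<psi>(1)]]
      by (rule e(2)[OF A_set_range[OF \<mu> \<psi>(1)] s(1) \<psi>(5) s(2)])
    then have "\<mu> (\<lambda>y\<in>topspace X. s \<odot> \<psi> y) < a" by (simp add: A_set_tnorm[OF \<mu> s(1) \<psi>(1)])
    moreover have "\<phi> y \<le> (\<lambda>y\<in>topspace X. s \<odot> \<psi> y) y" if "y \<in> U \<inter> ?V" for y
      using that \<psi>(4) tnorm_one_right[OF s(1)] CI_range[OF \<phi>, of y] by (auto simp: s_def)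
    moreover have "openin X (U \<inter> ?V)" "x \<in> U \<inter> ?V" using \<psi> V x e(1) by auto
    ultimately show ?thesis using CI_tnorm[OF s(1) \<psi>(1)] by blast
  qed
  then obtain g U where g: "\<And>x. x \<in> topspace X \<Longrightarrow> g x \<in> CI X" "\<And>x. x \<in> topspace X \<Longrightarrow> \<mu> (g x) < a"
    and U: "\<And>x. x \<in> topspace X \<Longrightarrow> openin X (U x)" "\<And>x. x \<in> topspace X \<Longrightarrow> x \<in> U x"
    and gU: "\<And>x y. x \<in> topspace X \<Longrightarrow> y \<in> U x \<Longrightarrow> \<phi> y \<le> g x y"
    by metis
  have "\<forall>V\<in>U ` topspace X. openin X V" "topspace X \<subseteq> \<Union>(U ` topspace X)" using U by auto
  moreover have "compact_space X" using X by (simp add: compactum_def)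
  ultimately have "\<exists>\<F>. finite \<F> \<and> \<F> \<subseteq> U ` topspace X \<and> topspace X \<subseteq> \<Union>\<F>"
    unfolding compact_space_alt by (elim allE[of _ "U ` topspace X"]) simp
  then obtain \<F> where \<F>: "finite \<F>" "\<F> \<subseteq> U ` topspace X" "topspace X \<subseteq> \<Union>\<F>" by blast
  obtain I where I: "I \<subseteq> topspace X" "finite I" "\<F> = U ` I"
    using finite_subset_image[OF \<F>(1,2)] by blast
  obtain h where h: "h \<in> CI X" "\<mu> h < a" "\<forall>k\<in>g ` I. \<forall>x\<in>topspace X. k x \<le> h x"
    using A_set_finite_upper_bound[OF \<mu> a, of "g ` I"] I g by blast
  have "\<phi> y \<le> h y" if y: "y \<in> topspace X" for y
  proof -
    obtain x where "x \<in> I" "y \<in> U x" using \<F>(3) I(3) y by blast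
    then have "\<phi> y \<le> g x y" "g x y \<le> h y" using gU I(1) h(3) y by auto
    then show ?thesis by simp
  qed
  then show ?thesis using A_set_mono[OF \<mu> \<phi> h(1)] h(2) by force
qed

text \<open>Were the density less than \<open>1\<close> everywhere, \<open>functional_less_if_density_less\<close> for the constant \<open>1\<close> would give
  \<open>\<mu> 1 < 1\<close>.\<close>

lemma functional_density_density:
  assumes X: "compactum X" and \<mu>: "\<mu> \<in> A_set (\<odot>) X"
  shows "density X (functional_density X \<mu>)"
proof -
  note usc = functional_density_unit_usc[OF \<mu>]
  have "\<exists>x\<in>topspace X. functional_density X \<mu> x = 1"
  proof (rule ccontr)
    assume none: "\<not> ?thesis"
    have one: "(\<lambda>x\<in>topspace X. 1) \<in> CI X" by (rule CI_const) simp
    have "functional_density X \<mu> x \<odot> (\<lambda>x\<in>topspace X. 1) x < 1" if x: "x \<in> topspace X" for x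
      using none functional_density_range[OF \<mu> x] tnorm_one_right[OF functional_density_range[OF \<mu> x]] x
      by force
    then have "\<mu> (\<lambda>x\<in>topspace X. 1) < 1"
      by (intro functional_less_if_density_less[OF X \<mu> one]) auto
    then show False using A_set_one[OF \<mu>] by simp
  qed
  with usc show ?thesis by (simp add: density_def)
qed

text \<open>The capacity is the one with density \<open>functional_density X \<mu>\<close>; the two inequalities between its
  integral and \<open>\<mu>\<close> are \<open>functional_density_tnorm_le\<close> and \<open>functional_less_if_density_less\<close>.\<close>

lemma l_map_surj:
  assumes X: "compactum X" and \<mu>: "\<mu> \<in> A_set (\<odot>) X"
  shows "\<exists>\<nu>\<in>possibilities X. l_map (\<odot>) X \<nu> = \<mu>"
proof
  let ?d = "functional_density X \<mu>"
  let ?\<nu> = "density_capacity X ?d"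
  note d = functional_density_density[OF X \<mu>]
  show \<nu>: "?\<nu> \<in> possibilities X" by (rule density_capacity_possibility[OF X d])
  note point = density_capacity_singleton[OF X, of _ ?d]
  show "l_map (\<odot>) X ?\<nu> = \<mu>"
  proof (rule extensionalityI)
    show "l_map (\<odot>) X ?\<nu> \<in> extensional (CI X)" "\<mu> \<in> extensional (CI X)"
      using A_set_extensional[OF l_map_in_A_set[OF X \<nu>]] A_set_extensional[OF \<mu>] .
    fix \<phi> assume \<phi>: "\<phi> \<in> CI X"
    let ?I = "sup_integral X ?\<nu> \<phi>"
    obtain x where x: "x \<in> topspace X" "?I = ?\<nu> {x} \<odot> \<phi> x"
      using sup_integral_attained[OF X \<nu> CI_unit_usc[OF \<phi>]] by blast
    have "?I \<le> \<mu> \<phi>"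
      using functional_density_tnorm_le[OF X \<mu> \<phi> x(1)] x point by simp
    moreover have "\<not> ?I < \<mu> \<phi>"
    proof
      assume less: "?I < \<mu> \<phi>"
      then have "0 < \<mu> \<phi>" using sup_integral_range[OF X \<nu> CI_unit_usc[OF \<phi>]] by auto
      moreover have "?d y \<odot> \<phi> y < \<mu> \<phi>" if y: "y \<in> topspace X" for y
        using sup_integral_upper[OF X \<nu> CI_unit_usc[OF \<phi>] y] less point[OF y] by simp
      ultimately have "\<mu> \<phi> < \<mu> \<phi>" by (rule functional_less_if_density_less[OF X \<mu> \<phi>])
      then show False by simp
    qed
    ultimately show "l_map (\<odot>) X ?\<nu> \<phi> = \<mu> \<phi>" by (simp add: l_map_eq_sup_integral[OF X \<nu> \<phi>])
  qed
qed

section \<open>The inverse transformation\<close>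

lemma l_inv_possibility:
  assumes "compactum X" "\<mu> \<in> A_set (\<odot>) X"
  shows "l_inv (\<odot>) X \<mu> \<in> possibilities X"
  using l_map_surj[OF assms] unfolding l_inv_def topspace_Pi_space
  by (metis image_eqI inv_into_into)

lemma l_map_l_inv:
  assumes "compactum X" "\<mu> \<in> A_set (\<odot>) X"
  shows "l_map (\<odot>) X (l_inv (\<odot>) X \<mu>) = \<mu>"
  using l_map_surj[OF assms] unfolding l_inv_def topspace_Pi_space
  by (metis image_eqI f_inv_into_f)

lemma l_inv_l_map:
  assumes "compactum X" "\<nu> \<in> possibilities X"
  shows "l_inv (\<odot>) X (l_map (\<odot>) X \<nu>) = \<nu>"
  using inv_into_f_f[OF l_map_inj[OF assms(1)] assms(2)] by (simp add: l_inv_def topspace_Pi_space)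

lemma l_inv_eqI:
  assumes "compactum X" "\<nu> \<in> possibilities X" "l_map (\<odot>) X \<nu> = \<mu>"
  shows "l_inv (\<odot>) X \<mu> = \<nu>"
  using l_inv_l_map[OF assms(1,2)] assms(3) by simp

lemma A_space_eval_open:
  assumes \<phi>: "\<phi> \<in> CI X"
  shows "openin (A_space (\<odot>) X) {\<mu> \<in> A_set (\<odot>) X. \<mu> \<phi> < a}"
    "openin (A_space (\<odot>) X) {\<mu> \<in> A_set (\<odot>) X. a < \<mu> \<phi>}"
proof -
  let ?e = "\<lambda>\<mu>\<in>topspace (A_space (\<odot>) X). \<mu> \<phi>"
  have *: "{\<mu> \<in> A_set (\<odot>) X. \<mu> \<phi> < a} = {\<mu> \<in> topspace (A_space (\<odot>) X). ?e \<mu> < a}"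
    "{\<mu> \<in> A_set (\<odot>) X. a < \<mu> \<phi>} = {\<mu> \<in> topspace (A_space (\<odot>) X). a < ?e \<mu>}"
    by (auto simp: topspace_A_space)
  show "openin (A_space (\<odot>) X) {\<mu> \<in> A_set (\<odot>) X. \<mu> \<phi> < a}"
    "openin (A_space (\<odot>) X) {\<mu> \<in> A_set (\<odot>) X. a < \<mu> \<phi>}"
    unfolding * using A_space_eval_CI[OF \<phi>]
    by (blast intro: upper_semicontinuous_openD CI_upper_semicontinuous CI_open_greater)+
qed

text \<open>The preimages of the two kinds of subbasic open sets are unions of sets \<open>{\<mu>. \<mu> \<phi> < a}\<close> and
  \<open>{\<mu>. a < \<mu> \<phi>}\<close>, by the descriptions of \<open>\<nu> F\<close> and \<open>\<nu> U\<close> in terms of integrals.\<close>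

lemma l_inv_continuous:
  assumes X: "compactum X"
  shows "continuous_map (A_space (\<odot>) X) (Pi_space X) (l_inv (\<odot>) X)"
  unfolding Pi_space_def continuous_map_in_subtopology
proof
  let ?A = "A_set (\<odot>) X" and ?\<theta> = "l_inv (\<odot>) X"
  have poss: "?\<theta> \<mu> \<in> possibilities X" if "\<mu> \<in> ?A" for \<mu> by (rule l_inv_possibility[OF X that])
  then have cap: "?\<theta> \<mu> \<in> capacities X" if "\<mu> \<in> ?A" for \<mu>
    using that by (simp add: possibilities_def)
  show "?\<theta> \<in> topspace (A_space (\<odot>) X) \<rightarrow> possibilities X"
    using poss by (auto simp: topspace_A_space)
  have below: "openin (A_space (\<odot>) X) {\<mu> \<in> ?A. ?\<theta> \<mu> F < a}" if F: "closedin X F" for F a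
  proof (cases "0 < a")
    case True
    have "{\<mu> \<in> ?A. ?\<theta> \<mu> F < a} = (\<Union>\<phi>\<in>{\<phi> \<in> CI X. \<forall>x\<in>F. \<phi> x = 1}. {\<mu> \<in> ?A. \<mu> \<phi> < a})"
      using possibility_less_iff_integral[OF X poss F True] by (auto simp: l_map_l_inv[OF X])
    then show ?thesis using A_space_eval_open(1) by (auto intro!: openin_clauses)
  next
    case False
    then have "{\<mu> \<in> ?A. ?\<theta> \<mu> F < a} = {}" using possibility_range[OF poss F] by force
    then show ?thesis by (simp only: openin_empty)
  qed
  have above: "openin (A_space (\<odot>) X) {\<mu> \<in> ?A. a < open_value X (?\<theta> \<mu>) U}"
    if U: "openin X U" and a: "a \<in> {0..1}" for U a
  proof -
    have "{\<mu> \<in> ?A. a < open_value X (?\<theta> \<mu>) U} =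
        (\<Union>\<phi>\<in>{\<phi> \<in> CI X. \<forall>x\<in>topspace X - U. \<phi> x = 0}. {\<mu> \<in> ?A. a < \<mu> \<phi>})"
      using open_value_greater_iff_integral[OF X poss U] a by (auto simp: l_map_l_inv[OF X])
    then show ?thesis using A_space_eval_open(2) by (auto intro!: openin_clauses)
  qed
  show "continuous_map (A_space (\<odot>) X) (capacity_space X) ?\<theta>"
    unfolding capacity_space_def
  proof (rule continuous_on_generated_topo)
    fix N assume "N \<in> {{c \<in> capacities X. c F < a} |F a. closedin X F \<and> a \<in> {0..1}} \<union>
      {{c \<in> capacities X. open_value X c U > a} |U a. openin X U \<and> a \<in> {0..1}}"
    then consider F a where "closedin X F" "N = {c \<in> capacities X. c F < a}"
      | U a where "openin X U" "a \<in> {0..1}" "N = {c \<in> capacities X. open_value X c U > a}"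
      by blast
    then show "openin (A_space (\<odot>) X) (?\<theta> -` N \<inter> topspace (A_space (\<odot>) X))"
    proof cases
      case 1
      have "?\<theta> -` N \<inter> topspace (A_space (\<odot>) X) = {\<mu> \<in> ?A. ?\<theta> \<mu> F < a}"
        using cap by (auto simp: 1 topspace_A_space)
      then show ?thesis using below 1 by simp
    next
      case 2
      have "?\<theta> -` N \<inter> topspace (A_space (\<odot>) X) = {\<mu> \<in> ?A. a < open_value X (?\<theta> \<mu>) U}"
        using cap by (auto simp: 2 topspace_A_space)
      then show ?thesis using above 2 by simp
    qed
  next
    have "?\<theta> ` topspace (A_space (\<odot>) X) \<subseteq> topspace (capacity_space X)"
      using cap by (auto simp: topspace_A_space topspace_capacity_space)
    then show "?\<theta> ` topspace (A_space (\<odot>) X) \<subseteq>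
      \<Union>({{c \<in> capacities X. c F < a} |F a. closedin X F \<and> a \<in> {0..1}} \<union>
        {{c \<in> capacities X. open_value X c U > a} |U a. openin X U \<and> a \<in> {0..1}})"
      unfolding capacity_space_def topology_generated_by_topspace .
  qed
qed

text \<open>Compactness and the Hausdorff property are transported from \<open>A\<^sup>* X\<close>, where they are inherited from a
  power of \<open>[0,1]\<close>, along the homeomorphism \<open>l\<close>.\<close>

lemma Pi_space_compactum:
  assumes X: "compactum X"
  shows "compactum (Pi_space X)"
proof -
  have "homeomorphic_maps (Pi_space X) (A_space (\<odot>) X) (l_map (\<odot>) X) (l_inv (\<odot>) X)"
    unfolding homeomorphic_maps_def topspace_Pi_space topspace_A_space
    using l_map_continuous[OF X] l_inv_continuous[OF X] l_inv_l_map[OF X] l_map_l_inv[OF X] by blast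
  then have "Pi_space X homeomorphic_space A_space (\<odot>) X"
    unfolding homeomorphic_space_def by blast
  then show ?thesis
    using A_space_compactum homeomorphic_compact_space homeomorphic_Hausdorff_space
    unfolding compactum_def by blast
qed

end

section \<open>Naturality\<close>

text \<open>Preimages commute with unions, so maxitivity carries over directly.  Outer regularity needs that
  a continuous map of compacta is closed: if \<open>U\<close> is an open neighbourhood of \<open>f\<inverse> F\<close>, the complement of
  \<open>f (X - U)\<close> is an open neighbourhood of \<open>F\<close> whose preimage lies in \<open>U\<close>.\<close>

lemma Pi_map_possibility:
  assumes X: "compactum X" and Y: "compactum Y" and f: "continuous_map X Y f"
    and \<nu>: "\<nu> \<in> possibilities X"
  shows "Pi_map X Y f \<nu> \<in> possibilities Y"
proof -
  let ?pre = "\<lambda>A. {x \<in> topspace X. f x \<in> A}"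
  let ?\<nu>' = "Pi_map X Y f \<nu>"
  have pre: "closedin X (?pre A)" if "closedin Y A" for A
    by (rule closedin_continuous_map_preimage[OF f that])
  have eval: "?\<nu>' A = \<nu> (?pre A)" if "closedin Y A" for A using that by (simp add: Pi_map_def)
  have fX: "f x \<in> topspace Y" if "x \<in> topspace X" for x
    using f that by (auto simp: continuous_map_def)
  have closed_f: "closed_map X Y f"
    using X Y f unfolding compactum_def
    by (intro continuous_imp_closed_map_gen Hausdorff_imp_kc_space) auto
  have mono: "?\<nu>' F \<le> ?\<nu>' G" if "closedin Y F" "closedin Y G" "F \<subseteq> G" for F G
    using that pre by (auto simp: eval intro!: possibility_mono[OF \<nu>])
  have "?pre (topspace Y) = topspace X" using fX by auto
  then have top: "?\<nu>' (topspace Y) = 1" using eval[of "topspace Y"] possibility_topspace[OF \<nu>] by simp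
  have empty: "?\<nu>' {} = 0" using eval[of "{}"] possibility_empty[OF \<nu>] by simp
  have "\<exists>V. openin Y V \<and> F \<subseteq> V \<and> (\<forall>B. compactin Y B \<and> B \<subseteq> V \<longrightarrow> ?\<nu>' B < a)"
    if F: "closedin Y F" "?\<nu>' F < a" and a: "a \<in> {0..1}" for F a
  proof -
    have "\<nu> (?pre F) < a" "a \<le> 1" using F a eval by auto
    then obtain U where U: "openin X U" "?pre F \<subseteq> U" "\<And>B. compactin X B \<Longrightarrow> B \<subseteq> U \<Longrightarrow> \<nu> B < a"
      using possibility_outer_regular[OF \<nu> pre[OF F(1)]] by blast
    define V where "V = topspace Y - f ` (topspace X - U)"
    have "closedin X (topspace X - U)" using U(1) by blast
    then have "closedin Y (f ` (topspace X - U))" using closed_f by (simp add: closed_map_def)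
    then have "openin Y V" by (simp add: V_def openin_diff)
    moreover have "F \<subseteq> V" using U(2) closedin_subset[OF F(1)] by (auto simp: V_def)
    moreover have "?\<nu>' B < a" if B: "compactin Y B" "B \<subseteq> V" for B
    proof -
      have closed: "closedin Y B" using B(1) compactin_iff_closedin[OF Y] by blast
      have "?pre B \<subseteq> U" using B(2) by (auto simp: V_def)
      then show ?thesis
        using U(3) pre[OF closed] compactin_iff_closedin[OF X] eval[OF closed] by simp
    qed
    ultimately show ?thesis by blast
  qed
  then have cap: "?\<nu>' \<in> capacities Y"
    unfolding capacities_def using mono top empty possibility_range[OF \<nu> pre]
    by (auto simp: Pi_map_def)
  have "?\<nu>' (\<Union>\<A>) = (SUP A\<in>\<A>. ?\<nu>' A)"
    if \<A>: "\<A> \<noteq> {}" "\<forall>A\<in>\<A>. closedin Y A" "closedin Y (\<Union>\<A>)" for \<A>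
  proof -
    have un: "?pre (\<Union>\<A>) = \<Union>(?pre ` \<A>)" by auto
    have closed: "\<forall>A\<in>?pre ` \<A>. closedin X A" "closedin X (\<Union>(?pre ` \<A>))"
      using pre \<A> pre[OF \<A>(3)] unfolding un by auto
    have sup: "\<forall>\<B>. \<B> \<noteq> {} \<and> (\<forall>A\<in>\<B>. closedin X A) \<and> closedin X (\<Union>\<B>) \<longrightarrow> \<nu> (\<Union>\<B>) = (SUP A\<in>\<B>. \<nu> A)"
      using \<nu> unfolding possibilities_def by simp
    have "\<nu> (\<Union>(?pre ` \<A>)) = (SUP A\<in>?pre ` \<A>. \<nu> A)"
      by (rule sup[rule_format]) (use closed \<A>(1) in simp)
    also have "\<dots> = (SUP A\<in>\<A>. \<nu> (?pre A))" by (simp add: image_image)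
    also have "\<dots> = (SUP A\<in>\<A>. ?\<nu>' A)" using \<A>(2) eval by (intro SUP_cong) auto
    finally show ?thesis unfolding eval[OF \<A>(3)] un .
  qed
  with cap show ?thesis by (simp add: possibilities_def)
qed

context cont_tnorm
begin

lemma A_map_A_set:
  assumes f: "continuous_map X Y f" and \<mu>: "\<mu> \<in> A_set (\<odot>) X"
  shows "A_map X Y f \<mu> \<in> A_set (\<odot>) Y"
proof (rule A_setI)
  let ?c = "\<lambda>\<phi>. \<lambda>x\<in>topspace X. \<phi> (f x)"
  have c: "?c \<phi> \<in> CI X" if "\<phi> \<in> CI Y" for \<phi> by (rule CI_compose[OF f that])
  have fX: "f x \<in> topspace Y" if "x \<in> topspace X" for x
    using f that by (auto simp: continuous_map_def)
  have eval: "A_map X Y f \<mu> \<phi> = \<mu> (?c \<phi>)" if "\<phi> \<in> CI Y" for \<phi> using that by (simp add: A_map_def)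
  show "A_map X Y f \<mu> \<in> CI Y \<rightarrow>\<^sub>E {0..1}"
    using A_set_range[OF \<mu> c] by (auto simp: A_map_def)
  have "?c (\<lambda>y\<in>topspace Y. 1::real) = (\<lambda>x\<in>topspace X. 1)" using fX by (intro restrict_ext) simp
  then show "A_map X Y f \<mu> (\<lambda>y\<in>topspace Y. 1) = 1"
    using eval[OF CI_const[of 1 Y]] A_set_one[OF \<mu>] by simp
  show "A_map X Y f \<mu> (\<lambda>y\<in>topspace Y. max (\<psi> y) (\<phi> y)) = max (A_map X Y f \<mu> \<psi>) (A_map X Y f \<mu> \<phi>)"
    if \<psi>: "\<psi> \<in> CI Y" and \<phi>: "\<phi> \<in> CI Y" for \<psi> \<phi>
  proof -
    have "?c (\<lambda>y\<in>topspace Y. max (\<psi> y) (\<phi> y)) = (\<lambda>x\<in>topspace X. max (?c \<psi> x) (?c \<phi> x))"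
      using fX by (intro restrict_ext) simp
    then show ?thesis
      unfolding eval[OF \<psi>] eval[OF \<phi>] eval[OF CI_max[OF \<psi> \<phi>]] A_set_max[OF \<mu> c[OF \<psi>] c[OF \<phi>], symmetric]
      by (rule arg_cong)
  qed
  show "A_map X Y f \<mu> (\<lambda>y\<in>topspace Y. c \<odot> \<phi> y) = c \<odot> A_map X Y f \<mu> \<phi>"
    if s: "c \<in> {0..1}" and \<phi>: "\<phi> \<in> CI Y" for c \<phi>
  proof -
    have "?c (\<lambda>y\<in>topspace Y. c \<odot> \<phi> y) = (\<lambda>x\<in>topspace X. c \<odot> ?c \<phi> x)"
      using fX by (intro restrict_ext) simp
    then show ?thesis
      unfolding eval[OF \<phi>] eval[OF CI_tnorm[OF s \<phi>]] A_set_tnorm[OF \<mu> s c[OF \<phi>], symmetric]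
      by (rule arg_cong)
  qed
qed

text \<open>The level sets of \<open>\<phi> \<circ> f\<close> are the preimages of the level sets of \<open>\<phi>\<close>, so both integrals are maxima
  of the same family.\<close>

lemma l_map_natural:
  assumes f: "continuous_map X Y f"
  shows "l_map (\<odot>) Y (Pi_map X Y f \<nu>) = A_map X Y f (l_map (\<odot>) X \<nu>)"
proof
  fix \<phi>
  show "l_map (\<odot>) Y (Pi_map X Y f \<nu>) \<phi> = A_map X Y f (l_map (\<odot>) X \<nu>) \<phi>"
  proof (cases "\<phi> \<in> CI Y")
    case True
    have level: "Pi_map X Y f \<nu> {y \<in> topspace Y. \<phi> y \<in> {t..1}} =
        \<nu> {x \<in> topspace X. (\<lambda>x\<in>topspace X. \<phi> (f x)) x \<in> {t..1}}" for t
    proof -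
      have "{y \<in> topspace Y. \<phi> y \<in> {t..1}} = {y \<in> topspace Y. t \<le> \<phi> y}"
        using CI_range[OF True] by auto
      then have "closedin Y {y \<in> topspace Y. \<phi> y \<in> {t..1}}"
        using upper_semicontinuous_closedD[OF CI_upper_semicontinuous[OF True]] by simp
      moreover have "{x \<in> topspace X. f x \<in> {y \<in> topspace Y. \<phi> y \<in> {t..1}}} =
          {x \<in> topspace X. (\<lambda>x\<in>topspace X. \<phi> (f x)) x \<in> {t..1}}"
        using f by (auto simp: continuous_map_def)
      ultimately show ?thesis by (simp add: Pi_map_def)
    qed
    have "tintegral (\<odot>) Y (Pi_map X Y f \<nu>) \<phi> =
        tintegral (\<odot>) X \<nu> (\<lambda>x\<in>topspace X. \<phi> (f x))"
      unfolding tintegral_def level ..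
    then show ?thesis using True CI_compose[OF f True] by (simp add: A_map_def l_map_def)
  qed (simp add: l_map_def A_map_def)
qed

section \<open>The units\<close>

text \<open>The density is the indicator function of \<open>x\<close>, which is upper semicontinuous since \<open>{x}\<close> is closed.\<close>

lemma Pi_unit_possibility:
  assumes X: "compactum X" and x: "x \<in> topspace X"
  shows "Pi_unit X x \<in> possibilities X"
proof -
  let ?d = "\<lambda>y. if y = x then 1 else 0 :: real"
  have "upper_semicontinuous X ?d"
  proof (rule upper_semicontinuousI_local)
    fix y a assume y: "y \<in> topspace X" "?d y < a"
    show "\<exists>U. openin X U \<and> y \<in> U \<and> (\<forall>z\<in>U. ?d z < a)"
    proof (cases "y = x")
      case True
      then show ?thesis using y by (intro exI[of _ "topspace X"]) auto
    next
      case False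
      then show ?thesis
        using y openin_diff[OF openin_topspace compactum_closed_singleton[OF X x]]
        by (intro exI[of _ "topspace X - {x}"]) auto
    qed
  qed
  then have d: "density X ?d" using x by (auto simp: density_def unit_usc_def)
  have "Pi_unit X x = density_capacity X ?d"
  proof (rule extensionalityI)
    show "Pi_unit X x \<in> extensional {F. closedin X F}"
      "density_capacity X ?d \<in> extensional {F. closedin X F}"
      by (auto simp: Pi_unit_def density_capacity_def)
    fix F assume "F \<in> {F. closedin X F}"
    then have F: "closedin X F" by simp
    show "Pi_unit X x F = density_capacity X ?d F"
    proof (cases "F = {}")
      case False
      obtain z where "z \<in> F" "density_capacity X ?d F = ?d z" "\<And>y. y \<in> F \<Longrightarrow> ?d y \<le> ?d z"
        using density_capacity_attained[OF X d F False] by blast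
      then show ?thesis using F by (force simp: Pi_unit_def split: if_splits)
    qed (simp add: Pi_unit_def density_capacity_def)
  qed
  then show ?thesis using density_capacity_possibility[OF X d] by simp
qed

lemma l_map_unit:
  assumes X: "compactum X" and x: "x \<in> topspace X"
  shows "l_map (\<odot>) X (Pi_unit X x) = A_unit X x"
proof
  fix \<phi>
  note \<nu> = Pi_unit_possibility[OF X x]
  show "l_map (\<odot>) X (Pi_unit X x) \<phi> = A_unit X x \<phi>"
  proof (cases "\<phi> \<in> CI X")
    case True
    have point: "Pi_unit X x {y} = (if y = x then 1 else 0)" if "y \<in> topspace X" for y
      using compactum_closed_singleton[OF X that] by (simp add: Pi_unit_def)
    obtain y where y: "y \<in> topspace X" "sup_integral X (Pi_unit X x) \<phi> = Pi_unit X x {y} \<odot> \<phi> y"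
      using sup_integral_attained[OF X \<nu> CI_unit_usc[OF True]] by blast
    have "Pi_unit X x {x} \<odot> \<phi> x \<le> sup_integral X (Pi_unit X x) \<phi>"
      by (rule sup_integral_upper[OF X \<nu> CI_unit_usc[OF True] x])
    then have "sup_integral X (Pi_unit X x) \<phi> = \<phi> x"
      using y point[OF x] point[OF y(1)] tnorm_one_left[OF CI_range[OF True x]]
        tnorm_zero_left[OF CI_range[OF True y(1)]] CI_range[OF True x]
      by (cases "y = x") auto
    then show ?thesis using True by (simp add: l_map_eq_sup_integral[OF X \<nu> True] A_unit_def)
  qed (simp add: l_map_def A_unit_def)
qed

section \<open>The multiplications\<close>

lemma Pi_mult_eq_sup_integral:
  assumes X: "compactum X" and w: "w \<in> possibilities (Pi_space X)" and F: "closedin X F"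
  shows "Pi_mult (\<odot>) X w F = sup_integral (Pi_space X) w (\<lambda>c. c F)"
proof -
  have "Pi_level X F t = {c \<in> topspace (Pi_space X). t \<le> c F}" for t
    by (simp add: Pi_level_def topspace_Pi_space)
  then have "Pi_mult (\<odot>) X w F = maximum ((\<lambda>t. w {c \<in> topspace (Pi_space X). t \<le> c F} \<odot> t) ` {0<..1})"
    using F by (simp add: Pi_mult_def)
  also have "\<dots> = sup_integral (Pi_space X) w (\<lambda>c. c F)"
    by (rule sup_integral_layers[OF Pi_space_compactum[OF X] w Pi_space_eval_upper_semicontinuous[OF F]])
      auto
  finally show ?thesis .
qed

text \<open>The density is \<open>x \<mapsto> max\<^sub>c w {c} \<odot> c {x}\<close>; it is upper semicontinuous because the function to be
  maximised is so jointly in \<open>(c, x)\<close> and \<open>\<Pi> X\<close> is compact.\<close>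

lemma Pi_mult_possibility:
  assumes X: "compactum X" and w: "w \<in> possibilities (Pi_space X)"
  shows "Pi_mult (\<odot>) X w \<in> possibilities X"
proof -
  note PX = Pi_space_compactum[OF X]
  note pt = compactum_closed_singleton[OF X]
  let ?e = "\<lambda>x. sup_integral (Pi_space X) w (\<lambda>c. c {x})"
  note usc = Pi_space_eval_upper_semicontinuous
  note point_range = possibility_point_range[OF X] possibility_point_range[OF PX w, unfolded topspace_Pi_space]
  let ?f = "\<lambda>z. ((\<lambda>c. w {c}) \<circ> fst) z \<odot> ((\<lambda>(x, c). c {x}) \<circ> (\<lambda>(c, x). (x, c))) z"
  have "upper_semicontinuous (prod_topology (Pi_space X) X) ?f"
  proof (rule upper_semicontinuous_tnorm)
    show "upper_semicontinuous (prod_topology (Pi_space X) X) ((\<lambda>c. w {c}) \<circ> fst)"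
      using possibility_point_unit_usc[OF PX w] unfolding unit_usc_def
      by (intro upper_semicontinuous_compose[OF _ continuous_map_fst]) simp
    show "upper_semicontinuous (prod_topology (Pi_space X) X) ((\<lambda>(x, c). c {x}) \<circ> (\<lambda>(c, x). (x, c)))"
      by (rule upper_semicontinuous_compose[OF density_jointly_upper_semicontinuous[OF X]])
        (simp add: case_prod_unfold continuous_map_paired continuous_map_fst continuous_map_snd)
  qed (auto simp: topspace_Pi_space point_range[simplified])
  then have "upper_semicontinuous X ?e"
  proof (rule upper_semicontinuous_marginal[rotated])
    show "compact_space (Pi_space X)" using PX by (simp add: compactum_def)
    fix x assume x: "x \<in> topspace X"
    show "\<exists>c\<in>topspace (Pi_space X). ?e x = ?f (c, x)"
      using sup_integral_attained[OF PX w usc[OF pt[OF x]]] by auto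
    show "?f (c, x) \<le> ?e x" if "c \<in> topspace (Pi_space X)" for c
      using sup_integral_upper[OF PX w usc[OF pt[OF x]] that] by simp
  qed
  moreover have e_range: "?e x \<in> {0..1}" if "x \<in> topspace X" for x
    by (rule sup_integral_range[OF PX w usc[OF pt[OF that]]])
  moreover have "\<exists>x\<in>topspace X. ?e x = 1"
  proof -
    obtain c where c: "c \<in> possibilities X" "w {c} = 1"
      using possibility_point_one[OF PX w] by (auto simp: topspace_Pi_space)
    obtain x where x: "x \<in> topspace X" "c {x} = 1" using possibility_point_one[OF X c(1)] by blast
    have "w {c} \<odot> c {x} \<le> ?e x"
      using c(1) by (intro sup_integral_upper[OF PX w usc[OF pt[OF x(1)]]]) (simp add: topspace_Pi_space)
    then show ?thesis
      using e_range[OF x(1)] x c(2) tnorm_one_right[of 1] by (intro bexI[of _ x]) auto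
  qed
  ultimately have e: "density X ?e" by (simp add: density_def unit_usc_def)
  have "Pi_mult (\<odot>) X w = density_capacity X ?e"
  proof (rule extensionalityI)
    show "Pi_mult (\<odot>) X w \<in> extensional {F. closedin X F}"
      "density_capacity X ?e \<in> extensional {F. closedin X F}"
      by (auto simp: Pi_mult_def density_capacity_def)
    fix F assume "F \<in> {F. closedin X F}"
    then have F: "closedin X F" by simp
    have "sup_integral (Pi_space X) w (\<lambda>c. c F) = density_capacity X ?e F"
    proof -
      obtain c where c: "c \<in> possibilities X" "sup_integral (Pi_space X) w (\<lambda>c. c F) = w {c} \<odot> c F"
        using sup_integral_attained[OF PX w usc[OF F]] by (auto simp: topspace_Pi_space)
      show ?thesis
      proof (cases "F = {}")
        case True
        then show ?thesis
          using c possibility_empty[OF c(1)] tnorm_zero_right[OF point_range(2)[OF c(1)]]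
          by (simp add: density_capacity_def)
      next
        case False
        obtain z where z: "z \<in> F" "density_capacity X ?e F = ?e z" "\<And>y. y \<in> F \<Longrightarrow> ?e y \<le> ?e z"
          using density_capacity_attained[OF X e F False] by blast
        have zX: "z \<in> topspace X" using z(1) closedin_subset[OF F] by blast
        obtain x where x: "x \<in> F" "c F = c {x}" using possibility_attained[OF X c(1) F False] by blast
        have xX: "x \<in> topspace X" using x(1) closedin_subset[OF F] by blast
        have "w {c} \<odot> c {x} \<le> ?e x"
          using c(1) by (intro sup_integral_upper[OF PX w usc[OF pt[OF xX]]]) (simp add: topspace_Pi_space)
        then have "sup_integral (Pi_space X) w (\<lambda>c. c F) \<le> ?e z" using z(3)[OF x(1)] c(2) x(2) by simp
        moreover have "?e z \<le> sup_integral (Pi_space X) w (\<lambda>c. c F)"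
          by (rule sup_integral_mono[OF PX w usc[OF pt[OF zX]] usc[OF F]])
            (simp add: topspace_Pi_space possibility_point_le[OF X _ F z(1)])
        ultimately show ?thesis using z(2) by simp
      qed
    qed
    then show "Pi_mult (\<odot>) X w F = density_capacity X ?e F"
      by (simp only: Pi_mult_eq_sup_integral[OF X w F])
  qed
  then show ?thesis using density_capacity_possibility[OF X e] by simp
qed

text \<open>By associativity both sides are the maximum of \<open>w {c} \<odot> c {x} \<odot> \<phi> x\<close> over all \<open>c\<close> and \<open>x\<close>.  As all
  maxima are attained, each inequality follows by inserting a maximising pair.\<close>

lemma sup_integral_Pi_mult:
  assumes X: "compactum X" and w: "w \<in> possibilities (Pi_space X)" and \<phi>: "\<phi> \<in> CI X"
  shows "sup_integral X (Pi_mult (\<odot>) X w) \<phi> =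
    sup_integral (Pi_space X) w (\<lambda>c\<in>topspace (Pi_space X). l_map (\<odot>) X c \<phi>)"
proof -
  note PX = Pi_space_compactum[OF X] and pt = compactum_closed_singleton[OF X]
    and usc = Pi_space_eval_upper_semicontinuous and mult = Pi_mult_possibility[OF X w]
    and \<phi>u = CI_unit_usc[OF \<phi>]
  let ?L = "\<lambda>c\<in>topspace (Pi_space X). l_map (\<odot>) X c \<phi>"
  have "continuous_map (Pi_space X) (top_of_set {0..1}) (\<lambda>c. l_map (\<odot>) X c \<phi>)"
    by (rule Pi_space_integral_continuous[OF X \<phi>])
  then have L: "unit_usc (Pi_space X) ?L"
    by (intro CI_unit_usc CI_restrict) (auto simp: continuous_map_in_subtopology image_subset_iff)
  have L_eq: "?L c = sup_integral X c \<phi>" if "c \<in> possibilities X" for c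
    using that by (simp add: topspace_Pi_space l_map_eq_sup_integral[OF X that \<phi>])
  have point: "Pi_mult (\<odot>) X w {x} = sup_integral (Pi_space X) w (\<lambda>c. c {x})" if "x \<in> topspace X" for x
    by (rule Pi_mult_eq_sup_integral[OF X w pt[OF that]])
  have wc: "w {c} \<in> {0..1}" if "c \<in> possibilities X" for c
    using possibility_point_range[OF PX w] that by (simp add: topspace_Pi_space)
  have assoc: "w {c} \<odot> c {x} \<odot> \<phi> x = w {c} \<odot> (c {x} \<odot> \<phi> x)"
    if "c \<in> possibilities X" "x \<in> topspace X" for c x
    by (rule tnorm_assoc[OF wc[OF that(1)] possibility_point_range[OF X that] CI_range[OF \<phi> that(2)]])
  show ?thesis
  proof (rule antisym)
    obtain x where x: "x \<in> topspace X"
      "sup_integral X (Pi_mult (\<odot>) X w) \<phi> = Pi_mult (\<odot>) X w {x} \<odot> \<phi> x"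
      using sup_integral_attained[OF X mult \<phi>u] by blast
    obtain c where c: "c \<in> possibilities X" "Pi_mult (\<odot>) X w {x} = w {c} \<odot> c {x}"
      unfolding point[OF x(1)]
      using sup_integral_attained[OF PX w usc[OF pt[OF x(1)]]] by (auto simp: topspace_Pi_space)
    have "c {x} \<odot> \<phi> x \<le> ?L c"
      unfolding L_eq[OF c(1)] by (rule sup_integral_upper[OF X c(1) \<phi>u x(1)])
    then have "w {c} \<odot> (c {x} \<odot> \<phi> x) \<le> w {c} \<odot> ?L c"
      using wc[OF c(1)] tnorm_closed[OF possibility_point_range[OF X c(1) x(1)] CI_range[OF \<phi> x(1)]]
        sup_integral_range[OF X c(1) \<phi>u]
      unfolding L_eq[OF c(1)] by (intro tnorm_mono) auto
    also have "\<dots> \<le> sup_integral (Pi_space X) w ?L"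
      by (rule sup_integral_upper[OF PX w L]) (simp add: topspace_Pi_space c(1))
    finally show "sup_integral X (Pi_mult (\<odot>) X w) \<phi> \<le> sup_integral (Pi_space X) w ?L"
      unfolding x(2) c(2) assoc[OF c(1) x(1)] .
  next
    obtain c where c: "c \<in> possibilities X" "sup_integral (Pi_space X) w ?L = w {c} \<odot> ?L c"
      using sup_integral_attained[OF PX w L] unfolding topspace_Pi_space by blast
    obtain x where x: "x \<in> topspace X" "?L c = c {x} \<odot> \<phi> x"
      unfolding L_eq[OF c(1)] using sup_integral_attained[OF X c(1) \<phi>u] by blast
    have "w {c} \<odot> c {x} \<le> Pi_mult (\<odot>) X w {x}"
      unfolding point[OF x(1)]
      by (rule sup_integral_upper[OF PX w usc[OF pt[OF x(1)]]]) (simp add: topspace_Pi_space c(1))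
    then have "w {c} \<odot> c {x} \<odot> \<phi> x \<le> Pi_mult (\<odot>) X w {x} \<odot> \<phi> x"
      using tnorm_closed[OF wc[OF c(1)] possibility_point_range[OF X c(1) x(1)]]
        possibility_point_range[OF X mult x(1)] CI_range[OF \<phi> x(1)]
      by (intro tnorm_mono) auto
    also have "\<dots> \<le> sup_integral X (Pi_mult (\<odot>) X w) \<phi>"
      by (rule sup_integral_upper[OF X mult \<phi>u x(1)])
    finally show "sup_integral (Pi_space X) w ?L \<le> sup_integral X (Pi_mult (\<odot>) X w) \<phi>"
      unfolding c(2) x(2) assoc[OF c(1) x(1)] .
  qed
qed

text \<open>By naturality at \<open>l : \<Pi> X \<rightarrow> A\<^sup>* X\<close>, evaluating the right-hand side at \<open>\<phi>\<close> means to integrate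
  \<open>c \<mapsto> \<integral>\<phi> dc\<close> against \<open>w\<close>.\<close>

lemma l_map_mult:
  assumes X: "compactum X" and w: "w \<in> possibilities (Pi_space X)"
  shows "l_map (\<odot>) X (Pi_mult (\<odot>) X w) =
    A_mult (\<odot>) X (l_map (\<odot>) (A_space (\<odot>) X) (Pi_map (Pi_space X) (A_space (\<odot>) X) (l_map (\<odot>) X) w))"
proof
  fix \<phi>
  show "l_map (\<odot>) X (Pi_mult (\<odot>) X w) \<phi> = A_mult (\<odot>) X (l_map (\<odot>) (A_space (\<odot>) X)
    (Pi_map (Pi_space X) (A_space (\<odot>) X) (l_map (\<odot>) X) w)) \<phi>"
  proof (cases "\<phi> \<in> CI X")
    case True
    let ?\<pi> = "\<lambda>\<mu>\<in>topspace (A_space (\<odot>) X). \<mu> \<phi>"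
    let ?L = "\<lambda>c\<in>topspace (Pi_space X). l_map (\<odot>) X c \<phi>"
    have comp: "(\<lambda>c\<in>topspace (Pi_space X). ?\<pi> (l_map (\<odot>) X c)) = ?L"
      by (intro restrict_ext) (simp add: topspace_Pi_space topspace_A_space l_map_in_A_set[OF X])
    have "?L \<in> CI (Pi_space X)"
      using CI_compose[OF l_map_continuous[OF X] A_space_eval_CI[OF True]] unfolding comp .
    then have "l_map (\<odot>) (Pi_space X) w ?L = sup_integral X (Pi_mult (\<odot>) X w) \<phi>"
      unfolding sup_integral_Pi_mult[OF X w True]
      by (rule l_map_eq_sup_integral[OF Pi_space_compactum[OF X] w])
    moreover have "A_mult (\<odot>) X (A_map (Pi_space X) (A_space (\<odot>) X) (l_map (\<odot>) X)
        (l_map (\<odot>) (Pi_space X) w)) \<phi> = l_map (\<odot>) (Pi_space X) w ?L"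
      using True A_space_eval_CI[OF True] comp by (simp add: A_mult_def A_map_def)
    ultimately show ?thesis
      unfolding l_map_natural[OF l_map_continuous[OF X]]
      by (simp add: l_map_eq_sup_integral[OF X Pi_mult_possibility[OF X w] True])
  qed (simp add: l_map_def A_mult_def)
qed

text \<open>Transporting \<open>W\<close> along \<open>A\<^sup>*\<close> of the inverse of \<open>l\<close> and back along \<open>A\<^sup>* l\<close> recovers \<open>W\<close>, so \<open>l_map_mult\<close>
  at the corresponding capacity shows that both sides have the same integral.\<close>

lemma l_inv_mult:
  assumes X: "compactum X" and W: "W \<in> A_set (\<odot>) (A_space (\<odot>) X)"
  shows "l_inv (\<odot>) X (A_mult (\<odot>) X W) =
    Pi_mult (\<odot>) X (l_inv (\<odot>) (Pi_space X) (A_map (A_space (\<odot>) X) (Pi_space X) (l_inv (\<odot>) X) W))"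
proof -
  note PX = Pi_space_compactum[OF X]
  let ?V = "A_map (A_space (\<odot>) X) (Pi_space X) (l_inv (\<odot>) X) W"
  let ?w = "l_inv (\<odot>) (Pi_space X) ?V"
  have V: "?V \<in> A_set (\<odot>) (Pi_space X)" by (rule A_map_A_set[OF l_inv_continuous[OF X] W])
  have w: "?w \<in> possibilities (Pi_space X)" by (rule l_inv_possibility[OF PX V])
  have "A_map (Pi_space X) (A_space (\<odot>) X) (l_map (\<odot>) X) ?V = W"
  proof (rule extensionalityI)
    show "A_map (Pi_space X) (A_space (\<odot>) X) (l_map (\<odot>) X) ?V \<in> extensional (CI (A_space (\<odot>) X))"
      "W \<in> extensional (CI (A_space (\<odot>) X))"
      using A_set_extensional[OF W] by (auto simp: A_map_def)
    fix \<Phi> assume \<Phi>: "\<Phi> \<in> CI (A_space (\<odot>) X)"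
    let ?\<Psi> = "\<lambda>c\<in>topspace (Pi_space X). \<Phi> (l_map (\<odot>) X c)"
    have \<Psi>: "?\<Psi> \<in> CI (Pi_space X)" by (rule CI_compose[OF l_map_continuous[OF X] \<Phi>])
    have "(\<lambda>\<mu>\<in>topspace (A_space (\<odot>) X). ?\<Psi> (l_inv (\<odot>) X \<mu>)) = \<Phi>"
      by (rule CI_ext[OF CI_compose[OF l_inv_continuous[OF X] \<Psi>] \<Phi>])
        (simp add: topspace_A_space topspace_Pi_space l_inv_possibility[OF X] l_map_l_inv[OF X])
    then show "A_map (Pi_space X) (A_space (\<odot>) X) (l_map (\<odot>) X) ?V \<Phi> = W \<Phi>"
      using \<Phi> \<Psi> by (simp add: A_map_def)
  qed
  then have "l_map (\<odot>) X (Pi_mult (\<odot>) X ?w) = A_mult (\<odot>) X W"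
    unfolding l_map_mult[OF X w] l_map_natural[OF l_map_continuous[OF X]] l_map_l_inv[OF PX V] by simp
  then show ?thesis by (rule l_inv_eqI[OF X Pi_mult_possibility[OF X w]])
qed

lemma l_inv_natural:
  assumes X: "compactum X" and Y: "compactum Y" and f: "continuous_map X Y f"
    and \<mu>: "\<mu> \<in> A_set (\<odot>) X"
  shows "Pi_map X Y f (l_inv (\<odot>) X \<mu>) = l_inv (\<odot>) Y (A_map X Y f \<mu>)"
  by (rule l_inv_eqI[OF Y Pi_map_possibility[OF X Y f l_inv_possibility[OF X \<mu>]], symmetric])
    (simp add: l_map_natural[OF f] l_map_l_inv[OF X \<mu>])

lemma l_inv_unit:
  assumes X: "compactum X" and x: "x \<in> topspace X"
  shows "l_inv (\<odot>) X (A_unit X x) = Pi_unit X x"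
  by (rule l_inv_eqI[OF X Pi_unit_possibility[OF X x] l_map_unit[OF X x]])

end

section \<open>The isomorphism of monads\<close>

theorem theorem2:
  fixes T :: "real \<Rightarrow> real \<Rightarrow> real"
  assumes "continuous_tnorm T"
  shows "monad_isomorphism
    (U_monad T ::
      ('a, 'b, 'a set \<Rightarrow> real, 'b set \<Rightarrow> real, ('a set \<Rightarrow> real) set \<Rightarrow> real) monad_data)
    (A_monad T ::
      ('a, 'b, ('a \<Rightarrow> real) \<Rightarrow> real, ('b \<Rightarrow> real) \<Rightarrow> real,
       ((('a \<Rightarrow> real) \<Rightarrow> real) \<Rightarrow> real) \<Rightarrow> real) monad_data)
    (l_map T) (l_map T)
    (\<lambda>X. l_map T (A_space T X) \<circ> Pi_map (Pi_space X) (A_space T X) (l_map T X))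
    (l_inv T) (l_inv T)
    (\<lambda>X. l_inv T (Pi_space X) \<circ> A_map (A_space T X) (Pi_space X) (l_inv T X))"
proof -
  interpret cont_tnorm T by unfold_locales (rule assms)
  show ?thesis
    unfolding monad_isomorphism_def monad_morphism_def natural_transformation_def U_monad_def
      A_monad_def monad_data.simps topspace_Pi_space topspace_A_space o_apply
    by (intro conjI allI impI ballI; (elim conjE)?)
      (auto intro: l_map_continuous l_inv_continuous l_inv_natural l_map_unit l_inv_unit l_map_mult
        l_inv_mult l_inv_l_map l_map_l_inv simp: l_map_natural)
qed

end
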